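(* Let $\alpha>1$ be non-integer. For estimating the $\alpha$-Rényi entropy $\mathrm{H}^{\mathrm{R\acute{e}n}}_\alpha(P)=\frac{1}{1-\alpha}\ln\big(\sum_{i=1}^d p_i^\alpha\big)$ of an unknown distribution $P$ on $\{1,\dots,d\}$ to within additive error $\varepsilon$, the quantum query complexity (in the purified quantum query access model) is $\Omega\!\left(\frac{d^{\frac12-\frac{1}{2\alpha}}}{\varepsilon}+d^{\frac12-o(1)}\right)$.
   Context: Purified quantum query access to a distribution $P=(p_1,\dots,p_d)$: a unitary $U$ on two registers $\mathsf{A},\mathsf{B}$ with $U\ket{0}_{\mathsf A}\ket{0}_{\mathsf B}=\sum_{i=1}^d\sqrt{p_i}\ket{i}_{\mathsf A}\ket{\psi_i}_{\mathsf B}$ for some orthonormal set $\{\ket{\psi_i}\}$; one query means one application of $U$, $U^\dagger$, controlled-$U$ or controlled-$U^\dagger$. The query complexity is the minimum number of queries of a quantum algorithm that outputs an $\varepsilon$-accurate estimate with probability at least $2/3$ for every input distribution; $o(1)$ is as $d\to\infty$. *)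

theory Defs
  imports Complex_Main
begin

text \<open>Finite-dimensional complex linear algebra, written with explicit dimensions.
  A matrix on C^N is a function nat => nat => complex of which only the entries
  with indices below N matter; a vector on C^N is a function nat => complex.\<close>

type_synonym cmat = "nat \<Rightarrow> nat \<Rightarrow> complex"
type_synonym cvec = "nat \<Rightarrow> complex"

definition mat_vec :: "nat \<Rightarrow> cmat \<Rightarrow> cvec \<Rightarrow> cvec" where
  "mat_vec N A v = (\<lambda>r. \<Sum>s<N. A r s * v s)"

definition adj :: "cmat \<Rightarrow> cmat" where
  "adj A = (\<lambda>r s. cnj (A s r))"

definition is_unitary :: "nat \<Rightarrow> cmat \<Rightarrow> bool" where
  "is_unitary N A \<longleftrightarrow>
     (\<forall>r<N. \<forall>s<N. (\<Sum>k<N. cnj (A k r) * A k s) = (if r = s then 1 else 0))"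

definition ket0 :: cvec where
  "ket0 = (\<lambda>r. if r = 0 then 1 else 0)"

text \<open>Probability distributions on d outcomes; outcome i (0 \<le> i < d) stands for i+1.\<close>
definition is_distribution :: "nat \<Rightarrow> (nat \<Rightarrow> real) \<Rightarrow> bool" where
  "is_distribution d p \<longleftrightarrow> (\<forall>i<d. 0 \<le> p i) \<and> (\<Sum>i<d. p i) = 1"

definition renyi_entropy :: "real \<Rightarrow> nat \<Rightarrow> (nat \<Rightarrow> real) \<Rightarrow> real" where
  "renyi_entropy \<alpha> d p = 1 / (1 - \<alpha>) * ln (\<Sum>i<d. p i powr \<alpha>)"

text \<open>Purified query access: U is a unitary on registers A (dim d) and B (dim m),
  with basis index i*m + j for |i>_A |j>_B, and
  U |0>|0> = sum_i sqrt(p_i) |i>|psi_i> for an orthonormal family psi_i in C^m.\<close>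
definition purified_oracle :: "nat \<Rightarrow> nat \<Rightarrow> (nat \<Rightarrow> real) \<Rightarrow> cmat \<Rightarrow> bool" where
  "purified_oracle d m p U \<longleftrightarrow>
     is_unitary (d * m) U \<and>
     (\<exists>\<psi> :: nat \<Rightarrow> cvec.
        (\<forall>i<d. \<forall>i'<d. (\<Sum>j<m. cnj (\<psi> i j) * \<psi> i' j) = (if i = i' then 1 else 0)) \<and>
        (\<forall>i<d. \<forall>j<m. U (i * m + j) 0 = complex_of_real (sqrt (p i)) * \<psi> i j))"

datatype qtype = Q_U | Q_Uadj | Q_cU | Q_cUadj

text \<open>Whole workspace: registers A (dim d), B (dim m), a control qubit C (dim 2)
  and a workspace W (dim w); basis index ((a * 2) + c) * w + k where a = i*m + j
  indexes A,B.  Total dimension d*m*2*w.  A query acts on A,B (controlled by C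
  for the controlled versions) and as identity on W.\<close>
definition ws_dim :: "nat \<Rightarrow> nat \<Rightarrow> nat \<Rightarrow> nat" where
  "ws_dim d m w = d * m * 2 * w"

definition query_op :: "nat \<Rightarrow> cmat \<Rightarrow> qtype \<Rightarrow> cmat" where
  "query_op w U q = (\<lambda>r s.
     if r mod (2 * w) \<noteq> s mod (2 * w) then 0
     else (let a = r div (2 * w); b = s div (2 * w); c = (r div w) mod 2;
               V = (if q = Q_Uadj \<or> q = Q_cUadj then adj U else U)
           in if (q = Q_cU \<or> q = Q_cUadj) \<and> c = 0 then (if a = b then 1 else 0)
              else V a b))"

definition final_state ::
  "nat \<Rightarrow> nat \<Rightarrow> nat \<Rightarrow> cmat \<Rightarrow> cmat \<Rightarrow> (qtype \<times> cmat) list \<Rightarrow> cvec" where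
  "final_state d m w U V0 steps =
     foldl (\<lambda>\<phi> (q, V). mat_vec (ws_dim d m w) V (mat_vec (ws_dim d m w) (query_op w U q) \<phi>))
           (mat_vec (ws_dim d m w) V0 ket0) steps"

definition success_prob ::
  "nat \<Rightarrow> nat \<Rightarrow> nat \<Rightarrow> cmat \<Rightarrow> cmat \<Rightarrow> (qtype \<times> cmat) list \<Rightarrow> (nat \<Rightarrow> real)
   \<Rightarrow> real \<Rightarrow> real \<Rightarrow> real" where
  "success_prob d m w U V0 steps est target \<epsilon> =
     (\<Sum>x\<in>{x. x < ws_dim d m w \<and> \<bar>est x - target\<bar> \<le> \<epsilon>}.
        (cmod (final_state d m w U V0 steps x))\<^sup>2)"

text \<open>There is a T-query algorithm estimating the property f to within eps with
  probability at least 2/3 for every distribution on d outcomes and every purified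
  oracle for it.  The algorithm may depend on the dimension m of register B
  (it must exist for every m), which only gives the algorithm more power.\<close>
definition estimates_with :: "nat \<Rightarrow> real \<Rightarrow> nat \<Rightarrow> ((nat \<Rightarrow> real) \<Rightarrow> real) \<Rightarrow> bool" where
  "estimates_with d \<epsilon> T f \<longleftrightarrow>
     (\<forall>m. \<exists>w > 0. \<exists>V0 steps est.
        length steps = T \<and>
        is_unitary (ws_dim d m w) V0 \<and>
        (\<forall>(q, V) \<in> set steps. is_unitary (ws_dim d m w) V) \<and>
        (\<forall>p U. is_distribution d p \<and> purified_oracle d m p U \<longrightarrow>
           success_prob d m w U V0 steps est (f p) \<epsilon> \<ge> 2 / 3))"

end

theory Submission
  imports Defs "HOL-Complex_Analysis.Complex_Analysis" "HOL-Real_Asymp.Real_Asymp"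
begin

text \<open>Let the oracle be the reflection exchanging \<open>|0\<rangle>|0\<rangle>\<close> with \<open>\<Sum>i. amp i |i\<rangle>|i + 1\<rangle>\<close>. Its entries are quadratic
  in the amplitudes, so a \<open>T\<close>-query acceptance probability, averaged over the signs of two amplitudes \<open>a\<close> and \<open>b\<close>
  with \<open>a\<^sup>2 + b\<^sup>2 = c\<close>, is a polynomial of degree \<open>n \<le> 4 T + 2\<close> in \<open>y = a\<^sup>2\<close> with values in \<open>{0..1}\<close> for \<open>y \<in> {0..c}\<close>.

  For the term in \<open>\<epsilon>\<close>, one element has probability \<open>x = d powr (1/\<alpha> - 1)\<close> or \<open>x (1 + C \<epsilon>)\<close> and the rest is uniform.
  The entropies differ by more than \<open>2 \<epsilon>\<close>, while by Bernstein's inequality the acceptance probability, as a function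
  of the angle \<open>arcsin (sqrt y)\<close>, is \<open>O(n)\<close>-Lipschitz, and the angles differ by only \<open>O(\<epsilon> sqrt x)\<close>.

  For the term \<open>d powr (1/2 - o(1))\<close>, fix \<open>L\<close> and draw the probabilities of \<open>N\<close>, a constant fraction of \<open>d\<close>, elements
  independently, \<open>t / (2 N)\<close> with \<open>t\<close> distributed according to \<open>\<nu>0\<close> or \<open>\<nu>1\<close>. These two laws have the same moments of
  order less than \<open>L\<close> but very different \<open>\<alpha>\<close>-th moments; they exist since \<open>\<alpha>\<close> is not an integer. Changing the law of
  one element changes the acceptance probability by \<open>O(n\<^sup>2 / N)\<^sup>L\<close>, because the \<open>k\<close>-th Taylor coefficient at 0 of a
  polynomial bounded on \<open>{0..c}\<close> is \<open>O(n\<^sup>2)\<^sup>k\<close>. Summing over the \<open>N\<close> elements gives \<open>T = \<Omega>(N powr (1/2 - 1/(2 L)))\<close>,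
  and finally \<open>L\<close> is sent to infinity slowly with \<open>d\<close>.\<close>

subsection \<open>Unitarity of the queries\<close>

lemma unitary_norm:
  assumes "is_unitary N A"
  shows "(\<Sum>r<N. (cmod (mat_vec N A v r))\<^sup>2) = (\<Sum>s<N. (cmod (v s))\<^sup>2)"
proof -
  have "complex_of_real (\<Sum>r<N. (cmod (mat_vec N A v r))\<^sup>2)
      = (\<Sum>r<N. cnj (\<Sum>s<N. A r s * v s) * (\<Sum>s<N. A r s * v s))"
    by (simp only: mat_vec_def of_real_sum complex_norm_square mult.commute)
  also have "\<dots> = (\<Sum>r<N. \<Sum>s<N. \<Sum>s'<N. cnj (v s) * v s' * (cnj (A r s) * A r s'))"
    unfolding cnj_sum sum_product by (simp add: mult_ac)
  also have "\<dots> = (\<Sum>s<N. \<Sum>s'<N. cnj (v s) * v s' * (\<Sum>r<N. cnj (A r s) * A r s'))"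
    by (subst sum.swap, rule sum.cong[OF refl], subst sum.swap) (simp add: sum_distrib_left)
  also have "\<dots> = (\<Sum>s<N. \<Sum>s'<N. cnj (v s) * v s' * (if s = s' then 1 else 0))"
    using assms by (intro sum.cong) (auto simp: is_unitary_def)
  also have "\<dots> = (\<Sum>s<N. cnj (v s) * v s)"
    by (rule sum.cong[OF refl])
      (simp add: if_distrib[where f = "\<lambda>x. _ * x"] sum.delta cong: if_cong)
  also have "\<dots> = complex_of_real (\<Sum>s<N. (cmod (v s))\<^sup>2)"
    by (simp only: of_real_sum complex_norm_square mult.commute)
  finally show ?thesis by (simp only: of_real_eq_iff)
qed

lemma sum_fixed_residue:
  fixes f :: "nat \<Rightarrow> complex"
  assumes "e < q" and "\<And>k. k < n * q \<Longrightarrow> k mod q \<noteq> e \<Longrightarrow> f k = 0"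
  shows "(\<Sum>k<n * q. f k) = (\<Sum>a<n. f (a * q + e))"
proof -
  have inj: "inj_on (\<lambda>a. a * q + e) {..<n}"
    using assms(1) by (auto simp: inj_on_def)
  have lt: "a * q + e < n * q" if "a < n" for a
    using that assms(1) mult_le_mono1[of "Suc a" n q] by simp
  have "(\<Sum>a<n. f (a * q + e)) = sum f ((\<lambda>a. a * q + e) ` {..<n})"
    by (simp add: sum.reindex[OF inj])
  also have "\<dots> = (\<Sum>k<n * q. f k)"
  proof (rule sum.mono_neutral_left)
    show "\<forall>k\<in>{..<n * q} - (\<lambda>a. a * q + e) ` {..<n}. f k = 0"
    proof
      fix k assume k: "k \<in> {..<n * q} - (\<lambda>a. a * q + e) ` {..<n}"
      have "k div q < n" using k assms(1) by (simp add: div_less_iff_less_mult)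
      hence "k mod q \<noteq> e" using k div_mult_mod_eq[of k q] by force
      thus "f k = 0" using k assms(2) by simp
    qed
  qed (use lt in auto)
  finally show ?thesis by simp
qed

text \<open>For self-adjoint \<open>U\<close> the daggered queries coincide with the plain ones. The
  control bit belonging to residue \<open>e\<close> is \<open>e div w\<close>, so
  \<open>e < w\<close> means that the control is off.\<close>

lemma query_op_entry:
  assumes sym: "adj U = U" and e: "e < 2 * w" "t mod (2 * w) = e"
  shows "query_op w U q (a * (2 * w) + e) t =
    (if (q = Q_cU \<or> q = Q_cUadj) \<and> e < w then (if a = t div (2 * w) then 1 else 0)
     else U a (t div (2 * w)))"
proof -
  have w: "w > 0" using e by simp
  have dv: "(a * (2 * w) + e) div (2 * w) = a" "(a * (2 * w) + e) mod (2 * w) = e"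
    using e(1) by simp_all
  have "(a * (2 * w) + e) div w = a * 2 + e div w"
    using w div_mult_self1[of w e "a * 2"] by (simp add: add.commute mult.assoc)
  then have "(a * (2 * w) + e) div w mod 2 = e div w mod 2"
    by simp
  also have "\<dots> = e div w"
    using e(1) by (simp add: less_mult_imp_div_less)
  finally have cc: "(a * (2 * w) + e) div w mod 2 = 0 \<longleftrightarrow> e < w"
    using w by (simp add: div_eq_0_iff)
  show ?thesis
    unfolding query_op_def Let_def dv cc e(2) sym by simp
qed

lemma query_op_unitary:
  assumes U: "is_unitary n U" and sym: "adj U = U" and w: "w > 0"
  shows "is_unitary (n * 2 * w) (query_op w U q)"
proof -
  define p where "p = 2 * w"
  have "(\<Sum>k<n * p. cnj (query_op w U q k r) * query_op w U q k s) = (if r = s then 1 else 0)"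
    if rs: "r < n * p" "s < n * p" for r s
  proof (cases "r mod p = s mod p")
    case False
    have "cnj (query_op w U q k r) * query_op w U q k s = 0" for k
      using False unfolding query_op_def p_def by simp
    then show ?thesis using False by (simp only: sum.neutral_const) auto
  next
    case True
    define e where "e = r mod p"
    have e: "e < p" "r mod p = e" "s mod p = e" using w True by (simp_all add: e_def p_def)
    have eq: "r = s \<longleftrightarrow> r div p = s div p"
      using True div_mult_mod_eq[of r p] div_mult_mod_eq[of s p] by metis
    have lt: "r div p < n" "s div p < n"
      using rs by (simp_all add: less_mult_imp_div_less)
    have "(\<Sum>k<n * p. cnj (query_op w U q k r) * query_op w U q k s)
       = (\<Sum>a<n. cnj (query_op w U q (a * p + e) r) * query_op w U q (a * p + e) s)"
    proof (rule sum_fixed_residue[OF e(1)])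
      show "cnj (query_op w U q k r) * query_op w U q k s = 0" if "k mod p \<noteq> e" for k
        using that e unfolding query_op_def p_def by simp
    qed
    also have "\<dots> = (if r = s then 1 else 0)"
    \<comment> \<open>On a fixed residue the query acts either as the identity (control off) or as
      \<open>U\<close>; both have orthonormal columns.\<close>
    proof (cases "(q = Q_cU \<or> q = Q_cUadj) \<and> e < w")
      case True
      have "query_op w U q (a * p + e) t = (if a = t div p then 1 else 0)" if "t mod p = e" for a t
        using True that e query_op_entry[OF sym, of e w t q a] by (simp add: p_def)
      then have "(\<Sum>a<n. cnj (query_op w U q (a * p + e) r) * query_op w U q (a * p + e) s)
         = (\<Sum>a<n. if a = r div p then (if r div p = s div p then 1 else 0) else 0)"
        using e by (intro sum.cong) auto
      then show ?thesis using lt eq by simp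
    next
      case False
      have "query_op w U q (a * p + e) t = U a (t div p)" if "t mod p = e" for a t
        using False that e query_op_entry[OF sym, of e w t q a] by (auto simp: p_def)
      then show ?thesis using e U lt eq by (simp add: is_unitary_def)
    qed
    finally show ?thesis .
  qed
  then show ?thesis unfolding is_unitary_def p_def mult.assoc by blast
qed

lemma final_state_norm:
  assumes U: "is_unitary (d * m) U" "adj U = U" and w: "w > 0" and "d * m > 0"
    and V0: "is_unitary (ws_dim d m w) V0"
    and Vs: "\<forall>(q, V) \<in> set steps. is_unitary (ws_dim d m w) V"
  shows "(\<Sum>x<ws_dim d m w. (cmod (final_state d m w U V0 steps x))\<^sup>2) = 1"
proof -
  let ?n = "ws_dim d m w"
  have "(\<Sum>x<?n. (cmod (foldl (\<lambda>\<phi> (q, V). mat_vec ?n V (mat_vec ?n (query_op w U q) \<phi>)) \<phi> steps x))\<^sup>2)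
      = (\<Sum>x<?n. (cmod (\<phi> x))\<^sup>2)" for \<phi>
    using Vs
  proof (induction steps arbitrary: \<phi>)
    case (Cons s steps)
    obtain q V where s: "s = (q, V)" by force
    have "is_unitary ?n (query_op w U q)"
      using query_op_unitary[OF U w] by (simp add: ws_dim_def)
    then show ?case using Cons by (simp add: s unitary_norm)
  qed simp
  moreover have "(\<Sum>x<?n. (cmod (ket0 x))\<^sup>2) = 1"
  proof -
    have "(\<Sum>x<?n. (cmod (ket0 x))\<^sup>2) = (\<Sum>x<?n. if x = 0 then 1 else 0)"
      by (rule sum.cong) (auto simp: ket0_def)
    also have "\<dots> = 1" using assms(3,4) by (simp add: ws_dim_def)
    finally show ?thesis .
  qed
  ultimately show ?thesis using V0 by (simp add: final_state_def unitary_norm)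
qed

subsection \<open>Polynomials in two amplitudes\<close>

text \<open>Polynomials on the circle \<open>a\<^sup>2 + b\<^sup>2 = c\<close>, decomposed by their parity in \<open>a\<close> and in \<open>b\<close>.\<close>

definition quad_poly :: "real \<Rightarrow> nat \<Rightarrow> (real \<Rightarrow> real \<Rightarrow> complex) \<Rightarrow> bool" where
  "quad_poly c n f \<longleftrightarrow> (\<exists>g0 g1 g2 g3 :: complex poly.
     degree g0 \<le> n \<and> degree g1 \<le> n \<and> degree g2 \<le> n \<and> degree g3 \<le> n \<and>
     (\<forall>a b. a\<^sup>2 + b\<^sup>2 = c \<longrightarrow>
        f a b = poly g0 (of_real (a\<^sup>2)) + of_real a * poly g1 (of_real (a\<^sup>2))
              + of_real b * poly g2 (of_real (a\<^sup>2)) + of_real (a * b) * poly g3 (of_real (a\<^sup>2))))"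

lemma quad_polyI:
  assumes "degree g0 \<le> n" "degree g1 \<le> n" "degree g2 \<le> n" "degree g3 \<le> n"
    and "\<And>a b. a\<^sup>2 + b\<^sup>2 = c \<Longrightarrow>
        f a b = poly g0 (of_real (a\<^sup>2)) + of_real a * poly g1 (of_real (a\<^sup>2))
              + of_real b * poly g2 (of_real (a\<^sup>2)) + of_real (a * b) * poly g3 (of_real (a\<^sup>2))"
  shows "quad_poly c n f"
  using assms unfolding quad_poly_def by blast

lemma quad_poly_const: "quad_poly c n (\<lambda>a b. z)"
  by (rule quad_polyI[of "[:z:]" _ 0 0 0]) auto

lemma quad_poly_mono:
  assumes "quad_poly c n f" "n \<le> n'" shows "quad_poly c n' f"
  using assms unfolding quad_poly_def by (meson order_trans)

lemma quad_poly_add: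
  assumes "quad_poly c n f" "quad_poly c n g"
  shows "quad_poly c n (\<lambda>a b. f a b + g a b)"
proof -
  obtain f0 f1 f2 f3 where f: "degree f0 \<le> n" "degree f1 \<le> n" "degree f2 \<le> n" "degree f3 \<le> n"
    "\<And>a b. a\<^sup>2 + b\<^sup>2 = c \<Longrightarrow>
        f a b = poly f0 (of_real (a\<^sup>2)) + of_real a * poly f1 (of_real (a\<^sup>2))
              + of_real b * poly f2 (of_real (a\<^sup>2)) + of_real (a * b) * poly f3 (of_real (a\<^sup>2))"
    using assms(1) unfolding quad_poly_def by blast
  obtain g0 g1 g2 g3 where g: "degree g0 \<le> n" "degree g1 \<le> n" "degree g2 \<le> n" "degree g3 \<le> n"
    "\<And>a b. a\<^sup>2 + b\<^sup>2 = c \<Longrightarrow>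
        g a b = poly g0 (of_real (a\<^sup>2)) + of_real a * poly g1 (of_real (a\<^sup>2))
              + of_real b * poly g2 (of_real (a\<^sup>2)) + of_real (a * b) * poly g3 (of_real (a\<^sup>2))"
    using assms(2) unfolding quad_poly_def by blast
  show ?thesis
    by (rule quad_polyI[of "f0 + g0" _ "f1 + g1" "f2 + g2" "f3 + g3"])
       (simp_all add: f g degree_add_le algebra_simps del: of_real_power)
qed

lemma quad_poly_cmult:
  assumes "quad_poly c n f"
  shows "quad_poly c n (\<lambda>a b. z * f a b)"
proof -
  obtain f0 f1 f2 f3 where f: "degree f0 \<le> n" "degree f1 \<le> n" "degree f2 \<le> n" "degree f3 \<le> n"
    "\<And>a b. a\<^sup>2 + b\<^sup>2 = c \<Longrightarrow>
        f a b = poly f0 (of_real (a\<^sup>2)) + of_real a * poly f1 (of_real (a\<^sup>2))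
              + of_real b * poly f2 (of_real (a\<^sup>2)) + of_real (a * b) * poly f3 (of_real (a\<^sup>2))"
    using assms(1) unfolding quad_poly_def by blast
  show ?thesis
    by (rule quad_polyI[of "smult z f0" _ "smult z f1" "smult z f2" "smult z f3"])
       (simp_all add: f algebra_simps order.trans[OF degree_smult_le] del: of_real_power)
qed

lemma quad_poly_sum:
  assumes "\<And>s. s \<in> S \<Longrightarrow> quad_poly c n (f s)"
  shows "quad_poly c n (\<lambda>a b. \<Sum>s\<in>S. f s a b)"
  using assms by (induction S rule: infinite_finite_induct) (auto intro: quad_poly_add quad_poly_const)

text \<open>Multiplication by \<open>a\<close> swaps the parts even and odd in \<open>a\<close>.
  Only the parts that were odd gain a factor \<open>a\<^sup>2\<close>, that is, one degree in the
  polynomial variable.\<close>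

lemma quad_poly_times_fst:
  assumes "quad_poly c n f"
  shows "quad_poly c (Suc n) (\<lambda>a b. of_real a * f a b)"
proof -
  obtain f0 f1 f2 f3 where f: "degree f0 \<le> n" "degree f1 \<le> n" "degree f2 \<le> n" "degree f3 \<le> n"
    "\<And>a b. a\<^sup>2 + b\<^sup>2 = c \<Longrightarrow>
        f a b = poly f0 (of_real (a\<^sup>2)) + of_real a * poly f1 (of_real (a\<^sup>2))
              + of_real b * poly f2 (of_real (a\<^sup>2)) + of_real (a * b) * poly f3 (of_real (a\<^sup>2))"
    using assms(1) unfolding quad_poly_def by blast
  show ?thesis
  proof (rule quad_polyI[of "pCons 0 f1" _ f0 "pCons 0 f3" f2])
    show "degree (pCons 0 f1) \<le> Suc n" "degree (pCons 0 f3) \<le> Suc n"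
      using f by (simp_all add: degree_pCons_le[THEN order.trans])
  qed (use f in \<open>simp_all add: algebra_simps power2_eq_square\<close>)
qed

text \<open>The argument for \<open>a\<close> applies, except that \<open>b\<^sup>2\<close> must be
  rewritten as \<open>c - a\<^sup>2\<close>; the new factor is the linear polynomial
  \<open>?q\<close>.\<close>

lemma quad_poly_times_snd:
  assumes "quad_poly c n f"
  shows "quad_poly c (Suc n) (\<lambda>a b. of_real b * f a b)"
proof -
  obtain f0 f1 f2 f3 where f: "degree f0 \<le> n" "degree f1 \<le> n" "degree f2 \<le> n" "degree f3 \<le> n"
    "\<And>a b. a\<^sup>2 + b\<^sup>2 = c \<Longrightarrow>
        f a b = poly f0 (of_real (a\<^sup>2)) + of_real a * poly f1 (of_real (a\<^sup>2))
              + of_real b * poly f2 (of_real (a\<^sup>2)) + of_real (a * b) * poly f3 (of_real (a\<^sup>2))"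
    using assms(1) unfolding quad_poly_def by blast
  let ?q = "[:of_real c, -1:] :: complex poly"
  have deg: "degree (?q * p) \<le> Suc n" if "degree p \<le> n" for p
    using that degree_mult_le[of ?q p] by (simp del: mult_pCons_left)
  show ?thesis
  proof (rule quad_polyI[of "?q * f2" _ "?q * f3" f0 f1])
    fix a b :: real assume ab: "a\<^sup>2 + b\<^sup>2 = c"
    then have c: "complex_of_real c = of_real a * of_real a + of_real b * of_real b"
      by (auto simp: power2_eq_square)
    show "of_real b * f a b = poly (?q * f2) (of_real (a\<^sup>2)) + of_real a * poly (?q * f3) (of_real (a\<^sup>2))
              + of_real b * poly f0 (of_real (a\<^sup>2)) + of_real (a * b) * poly f1 (of_real (a\<^sup>2))"
      unfolding f(5)[OF ab] poly_mult by (simp add: c power2_eq_square algebra_simps)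
  qed (use f deg in \<open>simp_all del: mult_pCons_left\<close>)
qed

lemma quad_poly_times_affine:
  assumes "quad_poly c n f"
  shows "quad_poly c (Suc n) (\<lambda>a b. of_real (\<gamma> + \<alpha> * a + \<beta> * b) * f a b)"
proof -
  have "quad_poly c (Suc n) (\<lambda>a b. of_real \<gamma> * f a b + of_real \<alpha> * (of_real a * f a b)
          + of_real \<beta> * (of_real b * f a b))"
    using assms quad_poly_mono[of c n f "Suc n"]
    by (intro quad_poly_add quad_poly_cmult quad_poly_times_fst quad_poly_times_snd) auto
  then show ?thesis by (simp add: algebra_simps)
qed

text \<open>Averaging over the signs of both variables kills the mixed terms.\<close>

lemma quad_poly_average_norm:
  assumes "quad_poly c n f"
  obtains G :: "complex poly" where "degree G \<le> 2 * n + 2"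
    "\<And>y. 0 \<le> y \<Longrightarrow> y \<le> c \<Longrightarrow> poly G (of_real y) = of_real
       (((cmod (f (sqrt y) (sqrt (c - y))))\<^sup>2 + (cmod (f (- sqrt y) (sqrt (c - y))))\<^sup>2
        + (cmod (f (sqrt y) (- sqrt (c - y))))\<^sup>2 + (cmod (f (- sqrt y) (- sqrt (c - y))))\<^sup>2) / 4)"
proof -
  obtain f0 f1 f2 f3 where f: "degree f0 \<le> n" "degree f1 \<le> n" "degree f2 \<le> n" "degree f3 \<le> n"
    "\<And>a b. a\<^sup>2 + b\<^sup>2 = c \<Longrightarrow>
        f a b = poly f0 (of_real (a\<^sup>2)) + of_real a * poly f1 (of_real (a\<^sup>2))
              + of_real b * poly f2 (of_real (a\<^sup>2)) + of_real (a * b) * poly f3 (of_real (a\<^sup>2))"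
    using assms(1) unfolding quad_poly_def by blast
  \<comment> \<open>Conjugating the coefficients makes \<open>N p\<close> a polynomial whose value
    at a real point is the squared modulus of the value of \<open>p\<close>.\<close>
  define N :: "complex poly \<Rightarrow> complex poly" where "N = (\<lambda>p. p * map_poly cnj p)"
  have N: "poly (N p) (of_real y) = of_real ((cmod (poly p (of_real y)))\<^sup>2)" for p y
    unfolding N_def complex_norm_square poly_cnj by simp
  have degN: "degree (N p) \<le> 2 * n" if "degree p \<le> n" for p
  proof -
    have "degree (map_poly cnj p) = degree p" by (rule degree_map_poly) simp
    then show ?thesis
      using that degree_mult_le[of p "map_poly cnj p"] unfolding N_def by linarith
  qed
  let ?x = "[:0, 1:] :: complex poly" and ?q = "[:of_real c, -1:] :: complex poly"
  \<comment> \<open>The factors are the squared moduli of the prefactors 1, \<open>a\<close>,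
    \<open>b\<close> and \<open>a * b\<close> at \<open>a\<^sup>2 = y\<close>,
    \<open>b\<^sup>2 = c - y\<close>; the last one accounts for the \<open>+ 2\<close> in the
    degree.\<close>
  define G where "G = N f0 + ?x * N f1 + ?q * N f2 + ?x * ?q * N f3"
  have deg1: "degree (?x * p) \<le> Suc (degree p)" "degree (?q * p) \<le> Suc (degree p)" for p
    using degree_mult_le[of ?x p] degree_mult_le[of ?q p] by (simp_all del: mult_pCons_left)
  have "degree (?x * ?q * N f3) \<le> Suc (Suc (degree (N f3)))"
    using deg1(1)[of "?q * N f3"] deg1(2)[of "N f3"] unfolding mult.assoc by linarith
  then have "degree G \<le> 2 * n + 2"
    unfolding G_def using degN[OF f(1)] degN[OF f(2)] degN[OF f(3)] degN[OF f(4)]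
      deg1(1)[of "N f1"] deg1(2)[of "N f2"]
    by (intro degree_add_le) linarith+
  moreover have "poly G (of_real y) = of_real
       (((cmod (f (sqrt y) (sqrt (c - y))))\<^sup>2 + (cmod (f (- sqrt y) (sqrt (c - y))))\<^sup>2
        + (cmod (f (sqrt y) (- sqrt (c - y))))\<^sup>2 + (cmod (f (- sqrt y) (- sqrt (c - y))))\<^sup>2) / 4)"
    if y: "0 \<le> y" "y \<le> c" for y
  proof -
    define z0 z1 z2 z3 where z: "z0 = poly f0 (of_real y)" "z1 = of_real (sqrt y) * poly f1 (of_real y)"
      "z2 = of_real (sqrt (c - y)) * poly f2 (of_real y)"
      "z3 = of_real (sqrt y) * of_real (sqrt (c - y)) * poly f3 (of_real y)"
    have ff: "f (sqrt y) (sqrt (c - y)) = z0 + z1 + z2 + z3"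
      "f (- sqrt y) (sqrt (c - y)) = z0 - z1 + z2 - z3"
      "f (sqrt y) (- sqrt (c - y)) = z0 + z1 - z2 - z3"
      "f (- sqrt y) (- sqrt (c - y)) = z0 - z1 - z2 + z3"
      using y by (simp_all add: f(5) z)
    \<comment> \<open>Parallelogram identity for the four sign patterns: every cross term
      cancels.\<close>
    have par: "((cmod (z0 + z1 + z2 + z3))\<^sup>2 + (cmod (z0 - z1 + z2 - z3))\<^sup>2 + (cmod (z0 + z1 - z2 - z3))\<^sup>2
        + (cmod (z0 - z1 - z2 + z3))\<^sup>2) / 4 = (cmod z0)\<^sup>2 + (cmod z1)\<^sup>2 + (cmod z2)\<^sup>2 + (cmod z3)\<^sup>2"
      unfolding cmod_power2 by (simp add: power2_eq_square algebra_simps)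
    have sq: "(cmod z1)\<^sup>2 = y * (cmod (poly f1 (of_real y)))\<^sup>2"
      "(cmod z2)\<^sup>2 = (c - y) * (cmod (poly f2 (of_real y)))\<^sup>2"
      "(cmod z3)\<^sup>2 = y * (c - y) * (cmod (poly f3 (of_real y)))\<^sup>2"
      using y by (simp_all add: z norm_mult power_mult_distrib)
    show ?thesis
      unfolding ff par sq unfolding G_def z(1) poly_add poly_mult N by simp
  qed
  ultimately show ?thesis by (rule that)
qed

subsection \<open>Bounded polynomials near the end of an interval\<close>

text \<open>The substitution \<open>y = - c (w - 1)\<^sup>2 / (4 w)\<close> maps the unit circle onto \<open>{0..c}\<close>, so \<open>w\<^sup>n G(y)\<close> is a
  polynomial in \<open>w\<close> bounded by 1 on the circle, hence on the disc.\<close>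

lemma bernstein_walsh:
  fixes G :: "complex poly"
  assumes deg: "degree G \<le> n" and c: "c > 0"
    and bound: "\<And>y. 0 \<le> y \<Longrightarrow> y \<le> c \<Longrightarrow> cmod (poly G (of_real y)) \<le> 1"
    and w: "w \<noteq> 0" "cmod w \<le> 1"
  shows "cmod (poly G (- of_real c * (w - 1)\<^sup>2 / (4 * w))) * cmod w ^ n \<le> 1"
proof -
  \<comment> \<open>This is \<open>w ^ n\<close> times \<open>G\<close> after the substitution, with
    the denominators cleared term by term, so that it is holomorphic at 0 too.\<close>
  define q where "q = (\<lambda>w. \<Sum>k\<le>n. coeff G k * (- of_real c * (w - 1)\<^sup>2 / 4) ^ k * w ^ (n - k))"
  have q: "q w = poly G (- of_real c * (w - 1)\<^sup>2 / (4 * w)) * w ^ n" if "w \<noteq> 0" for w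
  proof -
    have "poly G z = (\<Sum>k\<le>n. coeff G k * z ^ k)" for z
    proof -
      have "(\<Sum>k\<le>n. coeff G k * z ^ k) = (\<Sum>k\<le>degree G. coeff G k * z ^ k)"
        using deg by (intro sum.mono_neutral_right) (auto simp: coeff_eq_0)
      then show ?thesis by (simp add: poly_altdef)
    qed
    moreover have "(- of_real c * (w - 1)\<^sup>2 / 4) ^ k * w ^ (n - k)
        = (- of_real c * (w - 1)\<^sup>2 / (4 * w)) ^ k * w ^ n" if "k \<le> n" for k
    proof -
      have "- of_real c * (w - 1)\<^sup>2 / (4 * w) = (- of_real c * (w - 1)\<^sup>2 / 4) / w" by simp
      moreover have "a ^ k * w ^ (n - k) = (a / w) ^ k * w ^ n" for a
        using that \<open>w \<noteq> 0\<close> by (simp add: power_divide power_diff)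
      ultimately show ?thesis by simp
    qed
    ultimately show ?thesis
      unfolding q_def by (simp only: sum_distrib_right mult.assoc) (intro sum.cong, simp_all)
  qed
  have "cmod (q w) \<le> 1"
  proof (rule maximum_modulus_frontier[of q "cball 0 1"])
    show "q holomorphic_on interior (cball 0 1)" "continuous_on (closure (cball 0 1)) q"
      unfolding q_def by (auto intro!: holomorphic_intros continuous_intros)
    fix z :: complex assume "z \<in> frontier (cball 0 1)"
    then have z: "cmod z = 1" by simp
    then have z0: "z \<noteq> 0" and zz: "z * cnj z = 1" by (auto simp: complex_norm_square[symmetric])
    \<comment> \<open>On the unit circle \<open>1 / z = cnj z\<close>, so the substitution takes the
      real value \<open>c * (1 - Re z) / 2\<close>, which lies between 0 and
      \<open>c\<close>.\<close>
    have "(z - 1)\<^sup>2 / z = (z - 1)\<^sup>2 * cnj z"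
      using z0 zz by (simp add: field_simps)
    also have "\<dots> = (z * cnj z) * z - 2 * (z * cnj z) + cnj z"
      by (simp add: power2_eq_square algebra_simps)
    also have "\<dots> = of_real (2 * Re z - 2)"
      unfolding zz by (simp add: complex_eq_iff)
    finally have "- of_real c * (z - 1)\<^sup>2 / (4 * z) = - of_real c / 4 * of_real (2 * Re z - 2)"
      by (metis times_divide_times_eq)
    also have "\<dots> = of_real (c * (1 - Re z) / 2)"
      by (simp add: field_simps)
    finally have e: "- of_real c * (z - 1)\<^sup>2 / (4 * z) = of_real (c * (1 - Re z) / 2)" .
    have "\<bar>Re z\<bar> \<le> 1" using abs_Re_le_cmod[of z] z by simp
    then have "0 \<le> c * (1 - Re z) / 2" "c * (1 - Re z) / 2 \<le> c * 1"
      using c by (simp_all add: mult_left_mono del: mult_1_right)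
    then have "cmod (poly G (of_real (c * (1 - Re z) / 2))) \<le> 1"
      using bound by (simp del: of_real_mult of_real_divide)
    then show "cmod (q z) \<le> 1"
      unfolding q[OF z0] e norm_mult norm_power z by simp
  qed (use w in auto)
  then show ?thesis using q[OF w(1)] by (simp add: norm_mult norm_power)
qed

text \<open>Solving the substitution of \<open>bernstein_walsh\<close> for \<open>w\<close> gives a
  quadratic equation whose roots have product 1, so one root lies in the closed unit disc. The size
  of \<open>z\<close> forces this root to within \<open>1 / (2 * n)\<close> of 1, and Bernoulli's
  inequality then gives \<open>cmod w ^ n \<ge> 1 / 2\<close>.\<close>

lemma poly_bound_near_endpoint:
  fixes G :: "complex poly"
  assumes deg: "degree G \<le> n" and n: "n > 0" and c: "c > 0"
    and bound: "\<And>y. 0 \<le> y \<Longrightarrow> y \<le> c \<Longrightarrow> cmod (poly G (of_real y)) \<le> 1"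
    and z: "cmod z \<le> c / (16 * (real n)\<^sup>2)"
  shows "cmod (poly G z) \<le> 2"
proof -
  obtain w where w: "w\<^sup>2 + (4 * z / of_real c - 2) * w + 1 = 0" "w \<noteq> 0" "cmod w \<le> 1"
  proof -
    define B where "B = 4 * z / of_real c - 2"
    define s where "s = csqrt (B\<^sup>2 - 4)"
    define w1 w2 where w12: "w1 = (- B + s) / 2" "w2 = (- B - s) / 2"
    have s2: "s\<^sup>2 = B\<^sup>2 - 4" by (simp add: s_def)
    have prod: "w1 * w2 = 1"
    proof -
      have "w1 * w2 = (B\<^sup>2 - s\<^sup>2) / 4" by (simp add: w12 power2_eq_square field_simps)
      then show ?thesis by (simp add: s2)
    qed
    have sum: "w1 + w2 = - B" by (simp add: w12 field_simps)
    have "w\<^sup>2 + B * w + 1 = (w - w1) * (w - w2)" for w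
    proof -
      have "(w - w1) * (w - w2) = w\<^sup>2 - (w1 + w2) * w + w1 * w2"
        by (simp add: power2_eq_square algebra_simps)
      then show ?thesis by (simp add: prod sum)
    qed
    moreover have "cmod w1 \<le> 1 \<or> cmod w2 \<le> 1"
    proof (rule ccontr)
      assume "\<not> ?thesis"
      then have "1 * 1 < cmod w1 * cmod w2" by (intro mult_strict_mono) auto
      then show False using prod by (metis norm_mult norm_one less_irrefl mult_1_right)
    qed
    moreover have "w1 \<noteq> 0" "w2 \<noteq> 0" using prod by auto
    ultimately show ?thesis using that[of w1] that[of w2] unfolding B_def by auto
  qed
  define \<eta> where "\<eta> = 1 / (2 * real n)"
  have E: "(w - 1)\<^sup>2 = - 4 * z * w / of_real c"
  proof -
    have "(w - 1)\<^sup>2 = (w\<^sup>2 + (4 * z / of_real c - 2) * w + 1) - 4 * z * w / of_real c"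
      by (simp add: power2_eq_square algebra_simps)
    then show ?thesis by (simp add: w)
  qed
  then have ww: "- of_real c * (w - 1)\<^sup>2 / (4 * w) = z"
    using w(2) c by (simp add: field_simps)
  have nn: "(cmod (w - 1))\<^sup>2 = 4 * cmod z * cmod w / c"
    unfolding norm_power[symmetric] E using c by (simp add: norm_mult norm_divide)
  have "4 * cmod z * cmod w / c \<le> 4 * (c / (16 * (real n)\<^sup>2)) * 1 / c"
    using z w(3) c by (intro divide_right_mono mult_mono) auto
  also have "\<dots> = \<eta>\<^sup>2" using c by (simp add: \<eta>_def power_divide power_mult_distrib)
  finally have "cmod (w - 1) \<le> \<eta>"
    unfolding nn[symmetric] by (rule power2_le_imp_le) (simp add: \<eta>_def)
  then have "1 - \<eta> \<le> cmod w"
    using norm_triangle_ineq2[of 1 w] by (simp add: norm_minus_commute)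
  moreover have "\<eta> \<le> 1" using n by (simp add: \<eta>_def)
  ultimately have "(1 - \<eta>) ^ n \<le> cmod w ^ n"
    by (intro power_mono) auto
  moreover have "1 + real n * (- \<eta>) \<le> (1 + (- \<eta>)) ^ n"
    using \<open>\<eta> \<le> 1\<close> by (intro Bernoulli_inequality) auto
  moreover have "1 + real n * (- \<eta>) = 1 / 2" using n by (simp add: \<eta>_def)
  ultimately have "1 / 2 \<le> cmod w ^ n" by simp
  then have "cmod (poly G z) * (1 / 2) \<le> cmod (poly G z) * cmod w ^ n"
    by (intro mult_left_mono) auto
  also have "\<dots> \<le> 1" using bernstein_walsh[OF deg c bound w(2,3)] unfolding ww .
  finally show ?thesis by simp
qed

lemma higher_deriv_poly: "(deriv ^^ k) (poly p) = poly ((pderiv ^^ k) p)" for p :: "complex poly"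
proof (induction k)
  case (Suc k)
  have "deriv (poly q) = poly (pderiv q)" for q :: "complex poly"
    by (rule ext, rule DERIV_imp_deriv, rule poly_DERIV)
  then show ?case by (simp add: Suc)
qed simp

lemma poly_coeff_bound:
  fixes G :: "complex poly"
  assumes "r > 0" and "\<And>z. cmod z \<le> r \<Longrightarrow> cmod (poly G z) \<le> B"
  shows "cmod (coeff G k) \<le> B / r ^ k"
proof -
  have "cmod ((deriv ^^ k) (poly G) 0) \<le> fact k * B / r ^ k"
    by (rule Cauchy_inequality) (use assms in \<open>auto intro!: holomorphic_intros continuous_intros\<close>)
  also have "(deriv ^^ k) (poly G) 0 = fact k * coeff G k"
    by (simp add: higher_deriv_poly poly_0_coeff_0 coeff_higher_pderiv pochhammer_fact)
  finally show ?thesis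
    using \<open>r > 0\<close> by (simp add: norm_mult pos_le_divide_eq mult.commute)
qed

text \<open>The \<open>k\<close>-th Taylor coefficient at the endpoint is at most \<open>2 (16 n\<^sup>2 / c)\<^sup>k\<close>, and only the coefficients with
  \<open>k > L\<close> survive the functional.\<close>

lemma moment_functional_bound:
  fixes G :: "complex poly"
  assumes deg: "degree G \<le> n" and n: "n > 0" and c: "c > 0"
    and bound: "\<And>y. 0 \<le> y \<Longrightarrow> y \<le> c \<Longrightarrow> cmod (poly G (of_real y)) \<le> 1"
    and "finite J" and y: "\<And>j. j \<in> J \<Longrightarrow> 0 \<le> y j \<and> y j \<le> Y"
    and \<delta>1: "(\<Sum>j\<in>J. \<bar>\<delta> j\<bar>) \<le> 2"
    and moments: "\<And>k. k \<le> L \<Longrightarrow> (\<Sum>j\<in>J. \<delta> j * y j ^ k) = 0"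
    and small: "Y * (16 * (real n)\<^sup>2 / c) \<le> 1 / 2" and "0 \<le> Y"
  shows "cmod (\<Sum>j\<in>J. of_real (\<delta> j) * poly G (of_real (y j)))
     \<le> 8 * (Y * (16 * (real n)\<^sup>2 / c)) ^ Suc L"
proof -
  define r where "r = c / (16 * (real n)\<^sup>2)"
  define \<rho> where "\<rho> = Y * (16 * (real n)\<^sup>2 / c)"
  have r: "r > 0" and \<rho>: "\<rho> = Y / r" "0 \<le> \<rho>" "\<rho> \<le> 1 / 2"
    using c n small \<open>0 \<le> Y\<close> by (simp_all add: r_def \<rho>_def)
  have co: "cmod (coeff G k) \<le> 2 / r ^ k" for k
    by (rule poly_coeff_bound[OF r]) (use poly_bound_near_endpoint[OF deg n c bound] r_def in auto)
  have abs_mom: "\<bar>\<Sum>j\<in>J. \<delta> j * y j ^ k\<bar> \<le> 2 * Y ^ k" for k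
  proof -
    have "\<bar>\<Sum>j\<in>J. \<delta> j * y j ^ k\<bar> \<le> (\<Sum>j\<in>J. \<bar>\<delta> j * y j ^ k\<bar>)" by (rule sum_abs)
    also have "\<dots> \<le> (\<Sum>j\<in>J. \<bar>\<delta> j\<bar> * Y ^ k)"
      using y by (intro sum_mono) (auto simp: abs_mult power_abs intro!: mult_left_mono power_mono)
    also have "\<dots> \<le> 2 * Y ^ k"
      unfolding sum_distrib_right[symmetric] using \<delta>1 \<open>0 \<le> Y\<close> by (intro mult_right_mono) auto
    finally show ?thesis .
  qed
  have "(\<Sum>j\<in>J. of_real (\<delta> j) * poly G (of_real (y j)))
      = (\<Sum>j\<in>J. \<Sum>k\<le>degree G. coeff G k * of_real (\<delta> j * y j ^ k))"
    by (simp add: poly_altdef sum_distrib_left mult_ac)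
  also have "\<dots> = (\<Sum>k\<le>degree G. coeff G k * of_real (\<Sum>j\<in>J. \<delta> j * y j ^ k))"
    by (subst sum.swap) (simp add: sum_distrib_left)
  finally have "cmod (\<Sum>j\<in>J. of_real (\<delta> j) * poly G (of_real (y j)))
      \<le> (\<Sum>k\<le>degree G. cmod (coeff G k) * \<bar>\<Sum>j\<in>J. \<delta> j * y j ^ k\<bar>)"
    using norm_sum[of "\<lambda>k. coeff G k * of_real (\<Sum>j\<in>J. \<delta> j * y j ^ k)" "{..degree G}"]
    by (simp add: norm_mult del: of_real_sum)
  \<comment> \<open>Cauchy's inequality on the disc of radius \<open>r\<close> gives
    \<open>2 / r ^ k\<close> for the coefficient, and the total variation of \<open>\<delta>\<close>
    gives \<open>2 * Y ^ k\<close> for the moment.\<close>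
  also have "\<dots> \<le> (\<Sum>k\<le>degree G. if k \<le> L then 0 else 4 * \<rho> ^ k)"
  proof (rule sum_mono)
    fix k
    have "cmod (coeff G k) * \<bar>\<Sum>j\<in>J. \<delta> j * y j ^ k\<bar> \<le> 2 / r ^ k * (2 * Y ^ k)"
      using co abs_mom r by (intro mult_mono) auto
    then show "cmod (coeff G k) * \<bar>\<Sum>j\<in>J. \<delta> j * y j ^ k\<bar> \<le> (if k \<le> L then 0 else 4 * \<rho> ^ k)"
      using moments by (auto simp: \<rho>(1) power_divide)
  qed
  also have "\<dots> = (\<Sum>k\<in>{Suc L..degree G}. 4 * \<rho> ^ k)"
    by (rule sum.mono_neutral_cong_right) auto
  also have "\<dots> = (\<Sum>k\<in>{0..<Suc (degree G) - Suc L}. 4 * \<rho> ^ (k + Suc L))"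
    by (rule sum.reindex_bij_witness[of _ "\<lambda>k. k + Suc L" "\<lambda>k. k - Suc L"]) auto
  also have "\<dots> = 4 * \<rho> ^ Suc L * (\<Sum>k<Suc (degree G) - Suc L. \<rho> ^ k)"
    by (simp add: sum_distrib_left power_add mult_ac atLeast0LessThan)
  also have "\<dots> \<le> 4 * \<rho> ^ Suc L * (\<Sum>k<Suc (degree G) - Suc L. (1 / 2) ^ k)"
    using \<rho>(2,3) by (intro mult_left_mono sum_mono power_mono) auto
  also have "\<dots> \<le> 4 * \<rho> ^ Suc L * 2"
    by (rule mult_left_mono) (use \<rho>(2) in \<open>simp_all add: sum_gp_strict\<close>)
  finally show ?thesis by (simp add: \<rho>_def)
qed

text \<open>The function \<open>z \<mapsto> G (sin\<^sup>2 z)\<close> is entire and bounded by \<open>exp (2 n \<bar>Im z\<bar>)\<close>, so Cauchy's inequality on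
  discs of radius \<open>1 / n\<close> bounds its derivative on the real axis.\<close>

lemma sin_sq_poly_lipschitz:
  fixes G :: "complex poly"
  assumes deg: "degree G \<le> n" and n: "n > 0"
    and bound: "\<And>y. 0 \<le> y \<Longrightarrow> y \<le> 1 \<Longrightarrow> cmod (poly G (of_real y)) \<le> 1"
  shows "cmod (poly G (of_real ((sin s)\<^sup>2)) - poly G (of_real ((sin t)\<^sup>2))) \<le> 8 * real n * \<bar>s - t\<bar>"
proof -
  define H where "H = (\<lambda>z. poly G ((sin z)\<^sup>2))"
  have hol: "H holomorphic_on A" for A unfolding H_def by (intro holomorphic_intros)
  have up: "cmod (H z) \<le> exp (2 * real n * Im z)" if "Im z \<ge> 0" for z
  proof -
    \<comment> \<open>In this variable the substitution of \<open>bernstein_walsh\<close> with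
      \<open>c = 1\<close> becomes the squared sine.\<close>
    define w where "w = exp (2 * \<i> * z)"
    have w: "w \<noteq> 0" "cmod w = exp (- 2 * Im z)" by (simp_all add: w_def)
    have e: "exp (\<i> * z) * exp (- (\<i> * z)) = 1" by (simp flip: exp_add)
    have w2: "w = exp (\<i> * z) * exp (\<i> * z)" by (simp add: w_def mult.assoc flip: exp_add)
    have "- (w - 1)\<^sup>2 / (4 * w) = (sin z)\<^sup>2"
    proof -
      have "sin z * (2 * \<i> * exp (\<i> * z)) = w - 1"
        unfolding sin_exp_eq w2 using e by (simp add: field_simps)
      moreover have sq: "(2 * \<i> * exp (\<i> * z))\<^sup>2 = - 4 * w"
        by (simp add: w2 power2_eq_square)
      ultimately have "(w - 1)\<^sup>2 = (sin z)\<^sup>2 * (- 4 * w)"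
        by (metis sq power_mult_distrib)
      then show ?thesis using w(1) by simp
    qed
    then have "cmod (H z) * cmod w ^ n \<le> 1"
      using bernstein_walsh[OF deg zero_less_one bound w(1)] w(2) that by (simp add: H_def)
    also have "cmod w ^ n = exp (- (2 * real n * Im z))"
      by (simp add: w(2) flip: exp_of_nat_mult)
    finally show ?thesis by (simp add: exp_minus field_simps)
  qed
  \<comment> \<open>\<open>H\<close> is even, so the bound carries over to the lower
    half-plane.\<close>
  have all: "cmod (H z) \<le> exp (2 * real n * \<bar>Im z\<bar>)" for z
    using up[of z] up[of "- z"] by (cases "Im z \<ge> 0") (auto simp: H_def)
  have der: "cmod (deriv H (of_real x)) \<le> 8 * real n" for x
  proof -
    have "cmod ((deriv ^^ 1) H (of_real x)) \<le> fact 1 * exp 2 / (1 / real n) ^ 1"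
    proof (rule Cauchy_inequality)
      fix z assume "cmod (of_real x - z) = 1 / real n"
      then have "\<bar>Im z\<bar> \<le> 1 / real n"
        using abs_Im_le_cmod[of "of_real x - z"] by simp
      then have "2 * real n * \<bar>Im z\<bar> \<le> 2" using n by (simp add: field_simps)
      then show "cmod (H z) \<le> exp 2" using all[of z] by (meson exp_le_cancel_iff order_trans)
    qed (use n hol holomorphic_on_imp_continuous_on in auto)
    also have "exp 2 \<le> (8 :: real)"
    proof -
      have "exp 2 = exp 1 * exp (1 :: real)" by (simp flip: exp_add)
      also have "\<dots> \<le> 2.8 * 2.8" using e_less_272 by (intro mult_mono) auto
      finally show ?thesis by simp
    qed
    finally show ?thesis using n by (simp add: mult.commute mult_right_mono)
  qed
  have "cmod (H (of_real s) - H (of_real t)) \<le> 8 * real n * cmod (of_real s - of_real t)"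
  proof (rule field_differentiable_bound[of \<real> H "deriv H"])
    show "convex (\<real> :: complex set)"
      by (auto simp: convex_def Reals_def scaleR_conv_of_real simp flip: of_real_mult of_real_add)
    show "(H has_field_derivative deriv H z) (at z within \<real>)" for z
      using hol[of UNIV] holomorphic_derivI[of H UNIV z] by (auto intro: DERIV_subset)
  qed (use der in \<open>auto elim!: Reals_cases\<close>)
  then show ?thesis by (simp add: H_def sin_of_real flip: of_real_diff of_real_power)
qed

subsection \<open>Reflection oracles\<close>

lemma sum_blocks: "(\<Sum>r<n * m. f r) = (\<Sum>i<n. \<Sum>j<m. f (i * m + j :: nat))"
proof -
  have "(\<Sum>r<n * m. f r) = (\<Sum>i<n. sum f {i * m..<i * m + m})"
    by (rule sum.nat_group[symmetric])
  also have "\<dots> = (\<Sum>i<n. \<Sum>j<m. f (i * m + j))"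
  proof (rule sum.cong[OF refl])
    fix i
    show "sum f {i * m..<i * m + m} = (\<Sum>j<m. f (i * m + j))"
      by (rule sum.reindex_bij_witness[of _ "\<lambda>j. i * m + j" "\<lambda>r. r - i * m"]) auto
  qed
  finally show ?thesis .
qed

text \<open>Register B has dimension \<open>d + 1\<close> and \<open>|i>\<close> is paired with
  \<open>|i + 1>\<close>. The state \<open>|0>\<close> of B stays free, which makes this vector
  orthogonal to \<open>|0>|0>\<close>.\<close>

definition amp_vec :: "nat \<Rightarrow> (nat \<Rightarrow> real) \<Rightarrow> nat \<Rightarrow> real" where
  "amp_vec d amp r = (if r mod (d + 1) = r div (d + 1) + 1 then amp (r div (d + 1)) else 0)"

lemma amp_vec_index:
  assumes "j < d + 1"
  shows "amp_vec d amp (i * (d + 1) + j) = (if j = i + 1 then amp i else 0)"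
proof -
  have "(i * m + j) div m = i" "(i * m + j) mod m = j" if "j < m" for m using that by auto
  then show ?thesis unfolding amp_vec_def using assms by (simp only: split: if_split)
qed

definition refl_vec :: "nat \<Rightarrow> (nat \<Rightarrow> real) \<Rightarrow> nat \<Rightarrow> real" where
  "refl_vec d amp r = (if r = 0 then 1 else 0) - amp_vec d amp r"

text \<open>The Householder reflection that swaps \<open>|0\<rangle>|0\<rangle>\<close> with \<open>\<Sum>i. amp i |i\<rangle>|i + 1\<rangle>\<close>. As the two vectors are
  orthogonal, its entries are quadratic polynomials in the amplitudes.\<close>

definition refl_oracle :: "nat \<Rightarrow> (nat \<Rightarrow> real) \<Rightarrow> cmat" where
  "refl_oracle d amp = (\<lambda>r s. of_real ((if r = s then 1 else 0) - refl_vec d amp r * refl_vec d amp s))"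

lemma adj_refl_oracle: "adj (refl_oracle d amp) = refl_oracle d amp"
  by (auto simp: adj_def refl_oracle_def mult.commute fun_eq_iff)

text \<open>Both vectors have norm 1 and their supports are disjoint. Squared norm 2 is exactly what
  makes \<open>1 - v v^T\<close> a reflection without any normalising division, so its entries stay
  polynomial.\<close>

lemma refl_vec_norm:
  assumes "(\<Sum>i<d. (amp i)\<^sup>2) = 1"
  shows "(\<Sum>r<d * (d + 1). (refl_vec d amp r)\<^sup>2) = 2"
proof -
  have "d > 0" using assms by (cases d) auto
  have "(\<Sum>r<d * (d + 1). (amp_vec d amp r)\<^sup>2) = (\<Sum>i<d. \<Sum>j<d + 1. if j = i + 1 then (amp i)\<^sup>2 else 0)"
    unfolding sum_blocks
    by (intro sum.cong refl) (subst amp_vec_index, auto)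
  also have "\<dots> = (\<Sum>i<d. (amp i)\<^sup>2)"
    by (intro sum.cong refl) (simp del: sum.lessThan_Suc)
  finally have "(\<Sum>r<d * (d + 1). (amp_vec d amp r)\<^sup>2) = 1" by (simp only: assms)
  moreover have "(refl_vec d amp r)\<^sup>2 = (if r = 0 then 1 else 0) + (amp_vec d amp r)\<^sup>2" for r
    by (auto simp: refl_vec_def amp_vec_def power2_eq_square)
  ultimately show ?thesis using \<open>d > 0\<close> by (simp add: sum.distrib)
qed

text \<open>Expanding the square of \<open>1 - v v^T\<close> gives
  \<open>1 - 2 v v^T + |v|^2 v v^T\<close>, and \<open>|v|^2 = 2\<close>.\<close>

lemma reflection_orthogonal:
  fixes v :: "nat \<Rightarrow> real"
  assumes "(\<Sum>k<N. (v k)\<^sup>2) = 2" "r < N" "s < N"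
  shows "(\<Sum>k<N. ((if k = r then 1 else 0) - v k * v r) * ((if k = s then 1 else 0) - v k * v s))
      = (if r = s then 1 else 0)"
proof -
  have "((if k = r then 1 else 0) - v k * v r) * ((if k = s then 1 else 0) - v k * v s)
     = (if k = r then (if r = s then 1 else 0) else 0) - (if k = r then v r * v s else 0)
        - (if k = s then v r * v s else 0) + (v k)\<^sup>2 * (v r * v s)" for k
    by (cases "k = r"; cases "k = s") (simp_all add: power2_eq_square algebra_simps)
  then have "(\<Sum>k<N. ((if k = r then 1 else 0) - v k * v r) * ((if k = s then 1 else 0) - v k * v s))
     = (if r = s then 1 else 0) - v r * v s - v r * v s + (\<Sum>k<N. (v k)\<^sup>2) * (v r * v s)"
    using assms(2,3) by (simp add: sum.distrib sum_subtractf flip: sum_distrib_right)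
  then show ?thesis by (simp add: assms(1))
qed

lemma refl_oracle_unitary:
  assumes "(\<Sum>i<d. (amp i)\<^sup>2) = 1"
  shows "is_unitary (d * (d + 1)) (refl_oracle d amp)"
  unfolding is_unitary_def
proof (intro allI impI)
  let ?v = "refl_vec d amp"
  fix r s assume rs: "r < d * (d + 1)" "s < d * (d + 1)"
  have "(\<Sum>k<d * (d + 1). cnj (refl_oracle d amp k r) * refl_oracle d amp k s)
      = of_real (\<Sum>k<d * (d + 1). ((if k = r then 1 else 0) - ?v k * ?v r) * ((if k = s then 1 else 0) - ?v k * ?v s))"
    by (simp only: refl_oracle_def complex_cnj_complex_of_real of_real_mult of_real_sum)
  then show "(\<Sum>k<d * (d + 1). cnj (refl_oracle d amp k r) * refl_oracle d amp k s) = (if r = s then 1 else 0)"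
    unfolding reflection_orthogonal[OF refl_vec_norm[OF assms] rs] by simp
qed

text \<open>The access model demands the nonnegative amplitude \<open>sqrt (p i)\<close>, so the
  sign of \<open>amp i\<close> is moved into the vector \<open>\<psi> i\<close>. All sign patterns
  thus give legitimate oracles for one distribution, which justifies averaging over signs. A
  vanishing amplitude gets sign 1, keeping \<open>\<psi> i\<close> a unit vector.\<close>

lemma refl_oracle_purified:
  assumes "(\<Sum>i<d. (amp i)\<^sup>2) = 1"
  shows "purified_oracle d (d + 1) (\<lambda>i. (amp i)\<^sup>2) (refl_oracle d amp)"
proof -
  define \<psi> :: "nat \<Rightarrow> cvec" where
    "\<psi> = (\<lambda>i j. if j = i + 1 then (if amp i < 0 then -1 else 1) else 0)"
  have "(\<Sum>j<d + 1. cnj (\<psi> i j) * \<psi> i' j) = (if i = i' then 1 else 0)" if "i < d" for i i'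
  proof -
    have "(\<Sum>j<d + 1. cnj (\<psi> i j) * \<psi> i' j) = (\<Sum>j<d + 1. if j = i + 1 then (if i = i' then 1 else 0) else 0)"
      by (rule sum.cong) (auto simp: \<psi>_def)
    then show ?thesis using that by simp
  qed
  moreover have "refl_oracle d amp (i * (d + 1) + j) 0 = complex_of_real (sqrt ((amp i)\<^sup>2)) * \<psi> i j"
    if "i < d" "j < d + 1" for i j
  proof -
    have "amp_vec d amp (i * (d + 1) + j) = (if j = i + 1 then amp i else 0)"
      by (rule amp_vec_index[OF that(2)])
    moreover have "refl_oracle d amp r 0 = of_real (amp_vec d amp r)" for r
      by (auto simp: refl_oracle_def refl_vec_def amp_vec_def)
    ultimately show ?thesis by (auto simp: \<psi>_def)
  qed
  ultimately show ?thesis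
    using refl_oracle_unitary[OF assms] unfolding purified_oracle_def by blast
qed

section \<open>Final states and acceptance probabilities as polynomials in two amplitudes\<close>

lemma quad_poly_refl_oracle:
  assumes "quad_poly c n f"
  shows "quad_poly c (n + 2) (\<lambda>a b. refl_oracle d (\<lambda>i. \<gamma> i + \<alpha> i * a + \<beta> i * b) r s * f a b)"
proof -
  define e where "e = (\<lambda>g r. if r mod (d + 1) = r div (d + 1) + 1 then - (g (r div (d + 1))) else (0 :: real))"
  have v: "refl_vec d (\<lambda>i. \<gamma> i + \<alpha> i * a + \<beta> i * b) r
      = ((if r = 0 then 1 else 0) + e \<gamma> r) + e \<alpha> r * a + e \<beta> r * b" for a b r
    by (auto simp: refl_vec_def amp_vec_def e_def)
  have "quad_poly c (n + 2) (\<lambda>a b. of_real (if r = s then 1 else 0) * f a b +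
      (-1) * (of_real (((if r = 0 then 1 else 0) + e \<gamma> r) + e \<alpha> r * a + e \<beta> r * b) *
        (of_real (((if s = 0 then 1 else 0) + e \<gamma> s) + e \<alpha> s * a + e \<beta> s * b) * f a b)))"
    unfolding add_2_eq_Suc' using assms
    by (intro quad_poly_add quad_poly_cmult quad_poly_times_affine) (auto intro: quad_poly_mono)
  moreover have "of_real (\<delta> - x * y) * z = of_real \<delta> * z + (-1) * (of_real x * (of_real y * z))"
    for \<delta> x y :: real and z :: complex
    by (simp add: algebra_simps)
  ultimately show ?thesis
    unfolding refl_oracle_def v by (simp only:)
qed

lemma quad_poly_query:
  assumes "quad_poly c n f"
  shows "quad_poly c (n + 2) (\<lambda>a b. query_op w (refl_oracle d (\<lambda>i. \<gamma> i + \<alpha> i * a + \<beta> i * b)) q r s * f a b)"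
proof (cases "r mod (2 * w) = s mod (2 * w) \<and> \<not> ((q = Q_cU \<or> q = Q_cUadj) \<and> (r div w) mod 2 = 0)")
  case True
  then have "query_op w U q r s = U (r div (2 * w)) (s div (2 * w))" if "adj U = U" for U
    unfolding query_op_def Let_def that by auto
  then show ?thesis
    by (simp only: adj_refl_oracle quad_poly_refl_oracle[OF assms])
next
  case False
  then have "query_op w U q r s = (if r mod (2 * w) = s mod (2 * w) \<and> r div (2 * w) = s div (2 * w) then 1 else 0)" for U
    unfolding query_op_def Let_def by auto
  then show ?thesis
    using quad_poly_cmult quad_poly_mono[OF assms, of "n + 2"] by simp
qed

text \<open>An oracle entry is a product of two affine functions of \<open>a\<close> and
  \<open>b\<close> up to a constant, so each query adds 2 to the degree, while the gates between
  queries are constant. Taking squared moduli later turns \<open>2 * T\<close> into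
  \<open>4 * T + 2\<close>.\<close>

lemma quad_poly_final_state:
  "quad_poly c (2 * length steps)
     (\<lambda>a b. final_state d (d + 1) w (refl_oracle d (\<lambda>i. \<gamma> i + \<alpha> i * a + \<beta> i * b)) V0 steps x)"
proof -
  let ?n = "ws_dim d (d + 1) w" and ?U = "\<lambda>a b. refl_oracle d (\<lambda>i. \<gamma> i + \<alpha> i * a + \<beta> i * b)"
  have "quad_poly c (k + 2 * length steps) (\<lambda>a b. foldl
      (\<lambda>\<phi> (q, V). mat_vec ?n V (mat_vec ?n (query_op w (?U a b) q) \<phi>)) (\<phi> a b) steps x)"
    if "\<And>x. quad_poly c k (\<lambda>a b. \<phi> a b x)" for k and \<phi> :: "real \<Rightarrow> real \<Rightarrow> cvec"
    using that
  proof (induction steps arbitrary: k \<phi>)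
    case (Cons p steps)
    obtain q V where p: "p = (q, V)" by force
    have "quad_poly c (k + 2) (\<lambda>a b. mat_vec ?n V (mat_vec ?n (query_op w (?U a b) q) (\<phi> a b)) x)" for x
      unfolding mat_vec_def by (intro quad_poly_sum quad_poly_cmult quad_poly_query Cons.prems)
    from Cons.IH[OF this] show ?case by (simp add: p)
  qed simp
  from this[of 0 "\<lambda>a b. mat_vec ?n V0 ket0"] show ?thesis
    by (simp add: final_state_def quad_poly_const)
qed

text \<open>\<open>P amp\<close> is the probability that the estimate lies below a threshold.\<close>

lemma threshold_test:
  assumes est: "estimates_with d \<epsilon> T f" and gap: "2 * \<epsilon> < h0 - h1"
  obtains P :: "(nat \<Rightarrow> real) \<Rightarrow> real" where
    "\<And>amp. (\<Sum>i<d. (amp i)\<^sup>2) = 1 \<Longrightarrow> 0 \<le> P amp \<and> P amp \<le> 1"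
    "\<And>amp. (\<Sum>i<d. (amp i)\<^sup>2) = 1 \<Longrightarrow> f (\<lambda>i. (amp i)\<^sup>2) \<ge> h0 \<Longrightarrow> P amp \<le> 1 / 3"
    "\<And>amp. (\<Sum>i<d. (amp i)\<^sup>2) = 1 \<Longrightarrow> f (\<lambda>i. (amp i)\<^sup>2) \<le> h1 \<Longrightarrow> P amp \<ge> 2 / 3"
    "\<And>c \<gamma> \<alpha> \<beta>. \<exists>G :: complex poly. degree G \<le> 4 * T + 2 \<and> (\<forall>y. 0 \<le> y \<and> y \<le> c \<longrightarrow>
       poly G (of_real y) = of_real (\<Sum>s\<in>{-1, 1}. \<Sum>t\<in>{-1, 1}.
         P (\<lambda>i. \<gamma> i + \<alpha> i * (s * sqrt y) + \<beta> i * (t * sqrt (c - y))) / 4))"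
proof -
  obtain w V0 steps e where w: "w > 0" and len: "length steps = T"
    and V0: "is_unitary (ws_dim d (d + 1) w) V0"
    and Vs: "\<forall>(q, V) \<in> set steps. is_unitary (ws_dim d (d + 1) w) V"
    and succ: "\<And>p U. is_distribution d p \<Longrightarrow> purified_oracle d (d + 1) p U \<Longrightarrow>
           success_prob d (d + 1) w U V0 steps e (f p) \<epsilon> \<ge> 2 / 3"
    using est[unfolded estimates_with_def, rule_format, of "d + 1"] by blast
  let ?n = "ws_dim d (d + 1) w"
  define pr where "pr = (\<lambda>amp x. (cmod (final_state d (d + 1) w (refl_oracle d amp) V0 steps x))\<^sup>2)"
  \<comment> \<open>Accept when the estimate is at most \<open>h1 + \<epsilon>\<close>. If the
    property is at most \<open>h1\<close>, every accurate outcome is accepted; if it is at least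
    \<open>h0\<close>, none is, because the gap exceeds \<open>2 * \<epsilon>\<close>.\<close>
  define A where "A = {x. x < ?n \<and> e x \<le> h1 + \<epsilon>}"
  define P where "P = (\<lambda>amp. sum (pr amp) A)"
  have fin: "finite A" and sub: "A \<subseteq> {..<?n}" by (auto simp: A_def)
  have pr0: "pr amp x \<ge> 0" for amp x by (simp add: pr_def)
  have total: "sum (pr amp) {..<?n} = 1" if "(\<Sum>i<d. (amp i)\<^sup>2) = 1" for amp :: "nat \<Rightarrow> real"
  proof -
    have "d > 0" using that by (cases d) auto
    then show ?thesis
      unfolding pr_def using final_state_norm[OF refl_oracle_unitary[OF that] adj_refl_oracle w _ V0 Vs] by simp
  qed
  have good: "sum (pr amp) {x. x < ?n \<and> \<bar>e x - f (\<lambda>i. (amp i)\<^sup>2)\<bar> \<le> \<epsilon>} \<ge> 2 / 3"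
    if "(\<Sum>i<d. (amp i)\<^sup>2) = 1" for amp
    using succ[OF _ refl_oracle_purified[OF that]] that
    by (simp add: is_distribution_def success_prob_def pr_def)
  show ?thesis
  proof (rule that[of P])
    fix amp :: "nat \<Rightarrow> real" assume amp: "(\<Sum>i<d. (amp i)\<^sup>2) = 1"
    show "0 \<le> P amp \<and> P amp \<le> 1"
      using sum_mono2[OF _ sub, of "pr amp"] total[OF amp] pr0 by (auto simp: P_def sum_nonneg)
    let ?B = "{x. x < ?n \<and> \<bar>e x - f (\<lambda>i. (amp i)\<^sup>2)\<bar> \<le> \<epsilon>}"
    show "P amp \<le> 1 / 3" if "f (\<lambda>i. (amp i)\<^sup>2) \<ge> h0"
    proof -
      have "A \<inter> ?B = {}" using that gap by (auto simp: A_def)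
      then have "sum (pr amp) A + sum (pr amp) ?B = sum (pr amp) (A \<union> ?B)"
        using fin by (subst sum.union_disjoint) auto
      also have "\<dots> \<le> sum (pr amp) {..<?n}"
        using pr0 by (intro sum_mono2) (auto simp: A_def)
      finally show ?thesis using good[OF amp] total[OF amp] by (simp add: P_def)
    qed
    show "P amp \<ge> 2 / 3" if "f (\<lambda>i. (amp i)\<^sup>2) \<le> h1"
    proof -
      have "sum (pr amp) ?B \<le> sum (pr amp) A"
        using pr0 fin that by (intro sum_mono2) (auto simp: A_def)
      then show ?thesis using good[OF amp] by (simp add: P_def)
    qed
  next
    fix c and \<gamma> \<alpha> \<beta> :: "nat \<Rightarrow> real"
    let ?amp = "\<lambda>a b i. \<gamma> i + \<alpha> i * a + \<beta> i * b"
    define Q where "Q = (\<lambda>y x. (pr (?amp (sqrt y) (sqrt (c - y))) x + pr (?amp (- sqrt y) (sqrt (c - y))) x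
        + pr (?amp (sqrt y) (- sqrt (c - y))) x + pr (?amp (- sqrt y) (- sqrt (c - y))) x) / 4)"
    have "\<exists>G :: complex poly. degree G \<le> 4 * T + 2 \<and>
        (\<forall>y. 0 \<le> y \<and> y \<le> c \<longrightarrow> poly G (of_real y) = of_real (Q y x))" for x
    proof (rule quad_poly_average_norm[OF quad_poly_final_state[of c steps d w \<gamma> \<alpha> \<beta> V0 x]])
      fix G :: "complex poly"
      assume deg: "degree G \<le> 2 * (2 * length steps) + 2"
        and val: "\<And>y. 0 \<le> y \<Longrightarrow> y \<le> c \<Longrightarrow> poly G (of_real y) = of_real
         (((cmod (final_state d (d + 1) w (refl_oracle d (?amp (sqrt y) (sqrt (c - y)))) V0 steps x))\<^sup>2
         + (cmod (final_state d (d + 1) w (refl_oracle d (?amp (- sqrt y) (sqrt (c - y)))) V0 steps x))\<^sup>2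
         + (cmod (final_state d (d + 1) w (refl_oracle d (?amp (sqrt y) (- sqrt (c - y)))) V0 steps x))\<^sup>2
         + (cmod (final_state d (d + 1) w (refl_oracle d (?amp (- sqrt y) (- sqrt (c - y)))) V0 steps x))\<^sup>2) / 4)"
      have "poly G (of_real y) = of_real (Q y x)" if "0 \<le> y" "y \<le> c" for y
        unfolding Q_def pr_def by (rule val[OF that])
      moreover have "degree G \<le> 4 * T + 2" using deg by (simp add: len)
      ultimately show ?thesis by blast
    qed
    then obtain G :: "nat \<Rightarrow> complex poly" where G: "\<And>x. degree (G x) \<le> 4 * T + 2"
      "\<And>x y. 0 \<le> y \<Longrightarrow> y \<le> c \<Longrightarrow> poly (G x) (of_real y) = of_real (Q y x)"
      by metis
    have "degree (\<Sum>x\<in>A. G x) \<le> 4 * T + 2"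
      by (rule degree_sum_le[OF fin]) (rule G(1))
    moreover have "poly (\<Sum>x\<in>A. G x) (of_real y) = of_real (\<Sum>s\<in>{-1, 1}. \<Sum>t\<in>{-1, 1}.
         P (?amp (s * sqrt y) (t * sqrt (c - y))) / 4)" if y: "0 \<le> y" "y \<le> c" for y
    proof -
      have "(\<Sum>s\<in>{-1, 1}. \<Sum>t\<in>{-1, 1}. P (?amp (s * sqrt y) (t * sqrt (c - y))) / 4)
        = (P (?amp (sqrt y) (sqrt (c - y))) + P (?amp (- sqrt y) (sqrt (c - y)))
        + P (?amp (sqrt y) (- sqrt (c - y))) + P (?amp (- sqrt y) (- sqrt (c - y)))) / 4"
        by (simp add: field_simps)
      also have "\<dots> = sum (Q y) A"
        by (simp only: P_def Q_def sum.distrib sum_divide_distrib[symmetric])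
      finally have e: "(\<Sum>s\<in>{-1, 1}. \<Sum>t\<in>{-1, 1}. P (?amp (s * sqrt y) (t * sqrt (c - y))) / 4) = sum (Q y) A" .
      show ?thesis
        unfolding e poly_sum G(2)[OF y] by simp
    qed
    ultimately show "\<exists>G :: complex poly. degree G \<le> 4 * T + 2 \<and> (\<forall>y. 0 \<le> y \<and> y \<le> c \<longrightarrow>
       poly G (of_real y) = of_real (\<Sum>s\<in>{-1, 1}. \<Sum>t\<in>{-1, 1}.
         P (\<lambda>i. \<gamma> i + \<alpha> i * (s * sqrt y) + \<beta> i * (t * sqrt (c - y))) / 4))"
      by blast
  qed
qed

text \<open>Amplitudes of the hard instances: \<open>N\<close> individual elements, and \<open>d - N\<close> elements sharing a common mass
  \<open>b\<^sup>2\<close> that restores normalisation.\<close>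

definition inst :: "nat \<Rightarrow> nat \<Rightarrow> (nat \<Rightarrow> real) \<Rightarrow> real \<Rightarrow> nat \<Rightarrow> real" where
  "inst d N a b i = (if i < N then a i else b / sqrt (real (d - N)))"

lemma sum_inst:
  assumes "N < d"
  shows "(\<Sum>i<d. g (inst d N a b i)) = (\<Sum>i<N. g (a i)) + real (d - N) * g (b / sqrt (real (d - N)))"
proof -
  have "(\<Sum>i<d. g (inst d N a b i)) = (\<Sum>i\<in>{..<N} \<union> {N..<d}. g (inst d N a b i))"
    using assms by (intro sum.cong) auto
  also have "\<dots> = (\<Sum>i<N. g (inst d N a b i)) + (\<Sum>i\<in>{N..<d}. g (inst d N a b i))"
    by (rule sum.union_disjoint) auto
  also have "\<dots> = (\<Sum>i<N. g (a i)) + real (d - N) * g (b / sqrt (real (d - N)))"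
    using assms by (simp add: inst_def of_nat_diff)
  finally show ?thesis .
qed

lemma inst_norm:
  assumes "N < d"
  shows "(\<Sum>i<d. (inst d N a b i)\<^sup>2) = (\<Sum>i<N. (a i)\<^sup>2) + b\<^sup>2"
  using sum_inst[OF assms, of "\<lambda>x. x\<^sup>2" a b] assms by (simp add: power_divide)

lemma renyi_entropy_inst:
  assumes "N < d"
  shows "renyi_entropy \<alpha> d (\<lambda>i. (inst d N a b i)\<^sup>2)
    = ln ((\<Sum>i<N. (a i)\<^sup>2 powr \<alpha>) + (b\<^sup>2) powr \<alpha> * real (d - N) powr (1 - \<alpha>)) / (1 - \<alpha>)"
proof -
  have "(b\<^sup>2 / D) powr \<alpha> = b\<^sup>2 powr \<alpha> / D powr \<alpha>" for D
    by (rule powr_divide)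
  moreover have "D * (x / D powr \<alpha>) = x * D powr (1 - \<alpha>)" if "D > 0" for x D :: real
    using that by (simp add: powr_diff)
  ultimately have "real (d - N) * ((b / sqrt (real (d - N)))\<^sup>2 powr \<alpha>) = (b\<^sup>2) powr \<alpha> * real (d - N) powr (1 - \<alpha>)"
    using assms by (simp add: power_divide)
  then show ?thesis
    unfolding renyi_entropy_def sum_inst[OF assms, of "\<lambda>x. x\<^sup>2 powr \<alpha>"] by simp
qed

text \<open>Only the probability \<open>y\<close> of element \<open>i0\<close> varies, and the
  common mass absorbs the change. The two varying amplitudes lie on the circle of squared radius
  \<open>c\<close>, the mass left by the other individual elements, and the instance is affine in
  them.\<close>

lemma inst_acceptance_poly:
  fixes P :: "(nat \<Rightarrow> real) \<Rightarrow> real"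
  assumes P01: "\<And>amp. (\<Sum>i<d. (amp i)\<^sup>2) = 1 \<Longrightarrow> 0 \<le> P amp \<and> P amp \<le> 1"
    and Ppoly: "\<And>c \<gamma> \<alpha> \<beta>. \<exists>G :: complex poly. degree G \<le> n \<and> (\<forall>y. 0 \<le> y \<and> y \<le> c \<longrightarrow>
       poly G (of_real y) = of_real (\<Sum>s\<in>{-1, 1}. \<Sum>t\<in>{-1, 1}.
         P (\<lambda>i. \<gamma> i + \<alpha> i * (s * sqrt y) + \<beta> i * (t * sqrt (c - y))) / 4))"
    and N: "i0 < N" "N < d" and c: "c = 1 - (\<Sum>i\<in>{..<N} - {i0}. (a i)\<^sup>2)"
  obtains G :: "complex poly" where "degree G \<le> n"
    "\<And>y. 0 \<le> y \<Longrightarrow> y \<le> c \<Longrightarrow> poly G (of_real y) = of_real (\<Sum>s\<in>{-1, 1}. \<Sum>t\<in>{-1, 1}.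
         P (inst d N (a(i0 := s * sqrt y)) (t * sqrt (c - y))) / 4)"
    "\<And>y. 0 \<le> y \<Longrightarrow> y \<le> c \<Longrightarrow> cmod (poly G (of_real y)) \<le> 1"
proof -
  have e: "inst d N (a(i0 := x)) z = (\<lambda>i. (if i < N \<and> i \<noteq> i0 then a i else 0)
      + (if i = i0 then 1 else 0) * x + (if i < N then 0 else 1 / sqrt (real (d - N))) * z)" for x z
    using N by (auto simp: inst_def fun_eq_iff)
  obtain G :: "complex poly" where G: "degree G \<le> n"
    "\<And>y. 0 \<le> y \<Longrightarrow> y \<le> c \<Longrightarrow> poly G (of_real y) = of_real (\<Sum>s\<in>{-1, 1}. \<Sum>t\<in>{-1, 1}.
         P (inst d N (a(i0 := s * sqrt y)) (t * sqrt (c - y))) / 4)"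
    using Ppoly[of c "\<lambda>i. if i < N \<and> i \<noteq> i0 then a i else 0" "\<lambda>i. if i = i0 then 1 else 0"
        "\<lambda>i. if i < N then 0 else 1 / sqrt (real (d - N))"] unfolding e by blast
  moreover have "cmod (poly G (of_real y)) \<le> 1" if y: "0 \<le> y" "y \<le> c" for y
  proof -
    have P: "0 \<le> P (inst d N (a(i0 := s * sqrt y)) (t * sqrt (c - y))) \<and>
        P (inst d N (a(i0 := s * sqrt y)) (t * sqrt (c - y))) \<le> 1" if "s \<in> {-1, 1}" "t \<in> {-1, 1}" for s t
    proof (rule P01)
      have "(\<Sum>i<N. ((a(i0 := s * sqrt y)) i)\<^sup>2) = y + (\<Sum>i\<in>{..<N} - {i0}. (a i)\<^sup>2)"
        using N(1) that y by (subst sum.remove[of _ i0]) (auto simp: power_mult_distrib intro!: sum.cong)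
      moreover have "(t * sqrt (c - y))\<^sup>2 = c - y" using that y by (auto simp: power_mult_distrib)
      ultimately show "(\<Sum>i<d. (inst d N (a(i0 := s * sqrt y)) (t * sqrt (c - y)) i)\<^sup>2) = 1"
        unfolding inst_norm[OF N(2)] using c by simp
    qed
    have "0 \<le> (\<Sum>s\<in>{-1, 1}. \<Sum>t\<in>{-1, 1 :: real}. P (inst d N (a(i0 := s * sqrt y)) (t * sqrt (c - y))) / 4)"
      using P by (intro sum_nonneg) auto
    moreover have "(\<Sum>s\<in>{-1, 1}. \<Sum>t\<in>{-1, 1 :: real}. P (inst d N (a(i0 := s * sqrt y)) (t * sqrt (c - y))) / 4)
        \<le> (\<Sum>s\<in>{-1, 1 :: real}. \<Sum>t\<in>{-1, 1 :: real}. 1 / 4)"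
      using P by (intro sum_mono divide_right_mono) auto
    ultimately show ?thesis
      unfolding G(2)[OF y] norm_of_real by simp
  qed
  ultimately show ?thesis by (rule that)
qed

subsection \<open>Dependence on the accuracy\<close>

lemma powr_mean_value:
  fixes u v \<alpha> :: real
  assumes "0 < u" "u < v"
  obtains \<xi> where "u < \<xi>" "\<xi> < v" "v powr \<alpha> - u powr \<alpha> = (v - u) * (\<alpha> * \<xi> powr (\<alpha> - 1))"
proof -
  have "\<exists>z>u. z < v \<and> v powr \<alpha> - u powr \<alpha> = (v - u) * (\<alpha> * z powr (\<alpha> - 1))"
    using assms by (intro MVT2 has_real_derivative_powr) auto
  then show ?thesis using that by blast
qed

text \<open>Mean value theorem for the sine: where its square is at most 1/2, the cosine is at least
  1/2.\<close>

lemma arcsin_sqrt_diff_le: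
  assumes "0 \<le> y1" "y1 < y2" "y2 \<le> 1 / 2"
  shows "arcsin (sqrt y2) - arcsin (sqrt y1) \<le> 2 * (sqrt y2 - sqrt y1)"
proof -
  define s1 s2 where "s1 = arcsin (sqrt y1)" and "s2 = arcsin (sqrt y2)"
  have r: "sqrt y1 < sqrt y2" "0 \<le> sqrt y1" "sqrt y2 \<le> 1" using assms by (auto simp: real_sqrt_le_1_iff)
  have s: "s1 < s2" unfolding s1_def s2_def using r by (intro arcsin_less_mono[THEN iffD2]) auto
  have "arcsin (sqrt y2) \<le> pi / 2" by (rule arcsin_ubound) (use r in linarith)+
  then have b: "0 \<le> s1" "s2 \<le> pi / 2" using r arcsin_le_arcsin[of 0 "sqrt y1"]
    by (auto simp: s1_def s2_def)
  have sin: "sin s1 = sqrt y1" "sin s2 = sqrt y2"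
    unfolding s1_def s2_def by (rule sin_arcsin; use r in linarith)+
  have "\<exists>z>s1. z < s2 \<and> sin s2 - sin s1 = (s2 - s1) * cos z"
    using s by (intro MVT2) (auto intro: DERIV_sin)
  then obtain z where z: "s1 < z" "z < s2" "sin s2 - sin s1 = (s2 - s1) * cos z" by blast
  have "-1 \<le> sqrt y2" using r by linarith
  then have "cos s2 = sqrt (1 - y2)"
    unfolding s2_def using cos_arcsin[of "sqrt y2"] r(3) assms by force
  moreover have "1 / 2 \<le> sqrt (1 - y2)" using assms by (intro real_le_rsqrt) (simp add: power_divide)
  moreover have "cos s2 \<le> cos z" using z b by (intro cos_monotone_0_pi_le) auto
  ultimately have "(s2 - s1) * (1 / 2) \<le> (s2 - s1) * cos z" using s by (intro mult_left_mono) auto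
  then show ?thesis using z(3) sin by (simp add: s1_def s2_def)
qed

text \<open>The choice of \<open>x\<close> gives
  \<open>x powr \<alpha> = d powr (1 - \<alpha>)\<close>, so the heavy element and the uniform rest
  contribute comparably to the power sum. A relative change \<open>z\<close> of \<open>x\<close>
  then changes the power sum by a relative amount of order \<open>z\<close>.\<close>

lemma accuracy_lower_bound_aux:
  fixes \<alpha> :: real and d :: nat
  defines "x \<equiv> real d powr (1 / \<alpha> - 1)"
  defines "K \<equiv> 2 powr (\<alpha> - 1)"
  defines "C \<equiv> 8 * (1 + K)"
  assumes \<alpha>: "\<alpha> > 1" and d: "d \<ge> 2" and x: "x \<le> 1 / 4" "K * x \<le> 1 / 2" "1 / sqrt x \<ge> 96"
    and \<epsilon>: "0 < \<epsilon>" "C * \<epsilon> \<le> 1" "\<alpha> * (C * \<epsilon>) \<le> 1"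
    and est: "estimates_with d \<epsilon> T (renyi_entropy \<alpha> d)"
  shows "real T \<ge> 1 / sqrt x / \<epsilon> / (192 * C)"
proof -
  have K: "K > 0" and C: "C > 0" and x0: "x > 0" using d by (auto simp: K_def C_def x_def intro: add_pos_pos)
  define M where "M = real d powr (1 - \<alpha>)"
  define J where "J = real (d - 1) powr (1 - \<alpha>)"
  have M0: "M > 0" and J0: "J > 0" using d by (auto simp: M_def J_def)
  have "(1 / \<alpha> - 1) * \<alpha> = 1 - \<alpha>" using \<alpha> by (simp add: field_simps)
  then have xM: "x powr \<alpha> = M" by (simp only: x_def M_def powr_powr)
  have JM: "J \<le> K * M"
  proof -
    have "J \<le> (real d / 2) powr (1 - \<alpha>)"
      unfolding J_def using \<alpha> d by (intro powr_mono2') auto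
    also have "\<dots> = K * M"
      using d by (simp add: K_def M_def powr_divide powr_diff field_simps)
    finally show ?thesis .
  qed
  define z where "z = C * \<epsilon>"
  have z: "0 < z" "z \<le> 1" "\<alpha> * z \<le> 1" using \<epsilon> C by (auto simp: z_def)
  define y2 where "y2 = x * (1 + z)"
  have y2x: "y2 - x = x * z" by (simp add: y2_def algebra_simps)
  have y2: "x < y2" "y2 \<le> 1 / 2"
  proof -
    show "x < y2" using x0 z by (simp add: y2_def)
    have "x * (1 + z) \<le> (1 / 4) * 2" using x x0 z by (intro mult_mono) auto
    then show "y2 \<le> 1 / 2" by (simp add: y2_def)
  qed
  define S where "S = (\<lambda>y. y powr \<alpha> + (1 - y) powr \<alpha> * J)"
  have S1: "0 < S x" "S x \<le> M * (1 + K)"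
  proof -
    show "0 < S x" using x0 x(1) J0 by (simp add: S_def add_pos_pos)
    have "(1 - x) powr \<alpha> \<le> 1" using x0 x(1) \<alpha> by (intro powr_le1) auto
    then have "(1 - x) powr \<alpha> * J \<le> 1 * (K * M)" using JM J0 by (intro mult_mono) auto
    then show "S x \<le> M * (1 + K)" by (simp add: S_def xM algebra_simps)
  qed
  \<comment> \<open>The heavy term gains at least \<open>M * \<alpha> * z\<close>; since
    \<open>K * x \<le> 1 / 2\<close>, the shrinking of the uniform rest costs at most half of
    that.\<close>
  have S2: "S y2 - S x \<ge> M * (\<alpha> * z / 2)"
  proof -
    obtain \<xi> where \<xi>: "1 < \<xi>" "(1 + z) powr \<alpha> - 1 powr \<alpha> = (1 + z - 1) * (\<alpha> * \<xi> powr (\<alpha> - 1))"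
      using powr_mean_value[of 1 "1 + z" \<alpha>] z by auto
    have "1 \<le> \<xi> powr (\<alpha> - 1)" using \<xi>(1) \<alpha> by (intro ge_one_powr_ge_zero) auto
    then have "z * (\<alpha> * 1) \<le> z * (\<alpha> * \<xi> powr (\<alpha> - 1))"
      using z \<alpha> by (intro mult_left_mono) auto
    then have g: "\<alpha> * z \<le> (1 + z) powr \<alpha> - 1" using \<xi>(2) by (simp add: mult.commute)
    obtain \<eta> where \<eta>: "1 - y2 < \<eta>" "\<eta> < 1 - x"
      "(1 - x) powr \<alpha> - (1 - y2) powr \<alpha> = (1 - x - (1 - y2)) * (\<alpha> * \<eta> powr (\<alpha> - 1))"
      using powr_mean_value[of "1 - y2" "1 - x" \<alpha>] y2 by auto
    have "\<eta> powr (\<alpha> - 1) \<le> 1" using \<eta> y2 x0 \<alpha> by (intro powr_le1) auto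
    then have "x * z * (\<alpha> * \<eta> powr (\<alpha> - 1)) \<le> x * z * (\<alpha> * 1)"
      using x0 z \<alpha> by (intro mult_left_mono) auto
    then have l: "(1 - x) powr \<alpha> - (1 - y2) powr \<alpha> \<le> x * z * \<alpha>" using \<eta>(3) y2x by simp
    have "((1 - x) powr \<alpha> - (1 - y2) powr \<alpha>) * J \<le> (x * z * \<alpha>) * (K * M)"
      using l JM J0 x0 z \<alpha> by (intro mult_mono) auto
    also have "\<dots> = (K * x) * (M * (\<alpha> * z))" by simp
    also have "\<dots> \<le> (1 / 2) * (M * (\<alpha> * z))" using x(2) M0 \<alpha> z by (intro mult_right_mono) auto
    finally have "((1 - x) powr \<alpha> - (1 - y2) powr \<alpha>) * J \<le> M * (\<alpha> * z / 2)" by simp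
    moreover have "M * (\<alpha> * z) \<le> M * ((1 + z) powr \<alpha> - 1)" using g M0 by (intro mult_left_mono) auto
    moreover have "y2 powr \<alpha> = M * (1 + z) powr \<alpha>"
      using x0 z by (simp add: y2_def powr_mult xM)
    ultimately show ?thesis by (simp add: S_def xM algebra_simps)
  qed
  \<comment> \<open>A lower bound on the relative increase of \<open>S\<close>. The constant 8 in
    \<open>C\<close> makes \<open>u = 4 * \<alpha> * \<epsilon>\<close>, so even after
    \<open>ln (1 + u) \<ge> u / 2\<close> the entropy gap exceeds
    \<open>2 * \<epsilon>\<close>.\<close>
  define u where "u = \<alpha> * z / (2 * (1 + K))"
  have u: "0 \<le> u" "u \<le> 1 / 2"
  proof -
    show "0 \<le> u" using \<alpha> z K by (simp add: u_def)
    have "\<alpha> * z / (2 * (1 + K)) \<le> 1 / 2" using z K \<alpha> by (intro frac_le) auto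
    then show "u \<le> 1 / 2" by (simp add: u_def)
  qed
  have "S x * (1 + u) \<le> S y2"
  proof -
    have "S x * u \<le> M * (1 + K) * u" using S1 u by (intro mult_right_mono) auto
    also have "\<dots> = M * (\<alpha> * z / 2)" using K by (simp add: u_def field_simps)
    finally show ?thesis using S2 by (simp add: algebra_simps)
  qed
  then have "ln (S x * (1 + u)) \<le> ln (S y2)" using S1 u by (intro ln_mono) auto
  then have "ln (S x) + ln (1 + u) \<le> ln (S y2)" using S1 u by (simp add: ln_mult)
  moreover have "u - u\<^sup>2 \<le> ln (1 + u)" using u by (intro ln_one_plus_pos_lower_bound) auto
  moreover have "u\<^sup>2 \<le> u / 2" using u mult_left_mono[of u "1/2" u] by (simp add: power2_eq_square)
  moreover have "u / 2 = 2 * \<alpha> * \<epsilon>" using K by (simp add: u_def z_def C_def field_simps)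
  ultimately have lnS: "ln (S y2) - ln (S x) \<ge> 2 * \<alpha> * \<epsilon>" by linarith
  have "2 * \<epsilon> < ln (S x) / (1 - \<alpha>) - ln (S y2) / (1 - \<alpha>)"
  proof -
    have "2 * \<epsilon> * (\<alpha> - 1) < ln (S y2) - ln (S x)" using lnS \<epsilon>(1) by (simp add: algebra_simps)
    then have "2 * \<epsilon> < (ln (S y2) - ln (S x)) / (\<alpha> - 1)" using \<alpha> by (simp add: pos_less_divide_eq)
    also have "\<dots> = ln (S x) / (1 - \<alpha>) - ln (S y2) / (1 - \<alpha>)"
      using minus_divide_divide[of "ln (S y2) - ln (S x)" "\<alpha> - 1"] by (simp add: diff_divide_distrib)
    finally show ?thesis .
  qed
  note gap = this
  show ?thesis
  proof (rule threshold_test[OF est gap], goal_cases)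
  case (1 P)
  note P01 = 1(1) and P0 = 1(2) and P1 = 1(3) and Ppoly = 1(4)
  have N: "0 < (1 :: nat)" "1 < d" using d by auto
  have c: "1 = 1 - (\<Sum>i\<in>{..<1 :: nat} - {0}. ((\<lambda>_. 0 :: real) i)\<^sup>2)" by simp
  obtain G :: "complex poly" where deg: "degree G \<le> 4 * T + 2" and
    G: "\<And>y. 0 \<le> y \<Longrightarrow> y \<le> 1 \<Longrightarrow> poly G (of_real y) = of_real (\<Sum>s\<in>{-1, 1}. \<Sum>t\<in>{-1, 1}.
         P (inst d 1 ((\<lambda>_. 0)(0 := s * sqrt y)) (t * sqrt (1 - y))) / 4)" and
    G1: "\<And>y. 0 \<le> y \<Longrightarrow> y \<le> 1 \<Longrightarrow> cmod (poly G (of_real y)) \<le> 1"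
    by (rule inst_acceptance_poly[where P = P, OF P01 Ppoly N c]; (assumption | (rule that; assumption)))
  let ?amp = "\<lambda>s t y. inst d 1 ((\<lambda>_. 0)(0 := s * sqrt y)) (t * sqrt (1 - y))"
  have amp: "(\<Sum>i<d. (?amp s t y i)\<^sup>2) = 1" "renyi_entropy \<alpha> d (\<lambda>i. (?amp s t y i)\<^sup>2) = ln (S y) / (1 - \<alpha>)"
    if "s \<in> {-1, 1}" "t \<in> {-1, 1}" "0 \<le> y" "y \<le> 1" for s t y :: real
  proof -
    have "(s * sqrt y)\<^sup>2 = y" "(t * sqrt (1 - y))\<^sup>2 = 1 - y" using that by (auto simp: power_mult_distrib)
    then show "(\<Sum>i<d. (?amp s t y i)\<^sup>2) = 1" "renyi_entropy \<alpha> d (\<lambda>i. (?amp s t y i)\<^sup>2) = ln (S y) / (1 - \<alpha>)"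
      unfolding inst_norm[OF N(2)] renyi_entropy_inst[OF N(2)] S_def J_def by simp_all
  qed
  have xy: "0 \<le> x" "x \<le> 1" "0 \<le> y2" "y2 \<le> 1" using x0 x(1) y2 by auto
  have "Re (poly G (of_real x)) \<le> 1 / 3"
  proof -
    have "P (?amp s t x) \<le> 1 / 3" if "s \<in> {-1, 1}" "t \<in> {-1, 1}" for s t
      by (rule P0[OF amp(1)[OF that xy(1,2)] eq_refl[OF amp(2)[OF that xy(1,2), symmetric]]])
    then have "(\<Sum>s\<in>{-1, 1}. \<Sum>t\<in>{-1, 1}. P (?amp s t x) / 4) \<le> (\<Sum>s\<in>{-1, 1 :: real}. \<Sum>t\<in>{-1, 1 :: real}. (1 / 3) / 4)"
      by (intro sum_mono divide_right_mono) auto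
    then show ?thesis unfolding G[OF xy(1,2)] by simp
  qed
  moreover have "Re (poly G (of_real y2)) \<ge> 2 / 3"
  proof -
    have "P (?amp s t y2) \<ge> 2 / 3" if "s \<in> {-1, 1}" "t \<in> {-1, 1}" for s t
      by (rule P1[OF amp(1)[OF that xy(3,4)] eq_refl[OF amp(2)[OF that xy(3,4)]]])
    then have "(\<Sum>s\<in>{-1, 1 :: real}. \<Sum>t\<in>{-1, 1 :: real}. (2 / 3) / 4) \<le> (\<Sum>s\<in>{-1, 1}. \<Sum>t\<in>{-1, 1}. P (?amp s t y2) / 4)"
      by (intro sum_mono divide_right_mono) auto
    then show ?thesis unfolding G[OF xy(3,4)] by simp
  qed
  ultimately have "1 / 3 \<le> cmod (poly G (of_real y2) - poly G (of_real x))"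
    using abs_Re_le_cmod[of "poly G (of_real y2) - poly G (of_real x)"] by simp
  also have "\<dots> \<le> 8 * real (4 * T + 2) * \<bar>arcsin (sqrt y2) - arcsin (sqrt x)\<bar>"
  proof -
    have "(sin (arcsin (sqrt y)))\<^sup>2 = y" if "0 \<le> y" "y \<le> 1" for y
    proof -
      have "0 \<le> sqrt y" "sqrt y \<le> 1" using that by auto
      then have "sin (arcsin (sqrt y)) = sqrt y" by (intro sin_arcsin) linarith+
      then show ?thesis using that by simp
    qed
    then show ?thesis
      using sin_sq_poly_lipschitz[OF deg _ G1, of "arcsin (sqrt y2)" "arcsin (sqrt x)"] xy
      by (simp del: of_real_power)
  qed
  also have "\<bar>arcsin (sqrt y2) - arcsin (sqrt x)\<bar> \<le> sqrt x * z"
  proof -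
    have "sqrt y2 = sqrt x * sqrt (1 + z)" by (simp add: y2_def real_sqrt_mult)
    also have "\<dots> \<le> sqrt x * (1 + z / 2)"
      using z x0 by (intro mult_left_mono real_le_lsqrt) (auto simp: power2_eq_square algebra_simps)
    finally have "2 * (sqrt y2 - sqrt x) \<le> sqrt x * z" by (simp add: algebra_simps)
    moreover have "arcsin (sqrt x) \<le> arcsin (sqrt y2)"
      using x0 y2 by (intro arcsin_le_arcsin) (auto simp: real_sqrt_le_1_iff intro: order.trans[of _ 0])
    ultimately show ?thesis using arcsin_sqrt_diff_le[of x y2] x0 y2 by simp
  qed
  finally have main: "1 / 3 \<le> 8 * real (4 * T + 2) * (sqrt x * z)" by simp
  define X where "X = 1 / sqrt x"
  have X: "X > 0" "sqrt x = 1 / X" "X \<ge> 96" using x0 x(3) by (auto simp: X_def)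
  have "X / z \<le> 24 * real (4 * T + 2)"
    using main X(1) z(1) by (simp add: X(2) field_simps)
  then have "X / z \<le> 96 * real T + 48" by simp
  \<comment> \<open>This lower bound lets half of \<open>X / z\<close> absorb the additive 48 coming
    from the \<open>+ 2\<close> in the degree.\<close>
  moreover have "96 \<le> X / z" using X z frac_le[of X 96 1 z] by (simp add: field_simps)
  ultimately have "X / z \<le> 192 * real T" by linarith
  then have "X / z / 192 \<le> real T" by simp
  then show ?thesis by (simp add: X_def z_def mult_ac)
  qed
qed

lemma accuracy_lower_bound:
  fixes \<alpha> :: real
  assumes \<alpha>: "\<alpha> > 1"
  shows "\<exists>c > 0. \<exists>\<epsilon>0 > 0. \<exists>D. \<forall>d \<ge> D. \<forall>\<epsilon> T. 0 < \<epsilon> \<and> \<epsilon> < \<epsilon>0 \<and> estimates_with d \<epsilon> T (renyi_entropy \<alpha> d) \<longrightarrow>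
     real T \<ge> c * (real d powr (1/2 - 1/(2*\<alpha>)) / \<epsilon>)"
proof -
  define C where "C = 8 * (1 + 2 powr (\<alpha> - 1) :: real)"
  define K where "K = (2 powr (\<alpha> - 1) :: real)"
  have C: "C > 0" by (simp add: C_def add_pos_pos)
  have e: "1 / \<alpha> - 1 < 0" using \<alpha> by simp
  have lim: "(\<lambda>d. real d powr (1 / \<alpha> - 1)) \<longlonglongrightarrow> 0"
    using tendsto_neg_powr[OF e filterlim_real_sequentially] .
  \<comment> \<open>The three entries are the three smallness conditions on \<open>x\<close> in
    \<open>accuracy_lower_bound_aux\<close>.\<close>
  define m where "m = Min {1 / 4, 1 / (2 * K), 1 / 96\<^sup>2}"
  have m: "m > 0" by (simp add: m_def K_def)
  have "eventually (\<lambda>d. real d powr (1 / \<alpha> - 1) < m) sequentially"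
    using order_tendstoD(2)[OF lim m] .
  then obtain D where D: "\<And>d. d \<ge> D \<Longrightarrow> real d powr (1 / \<alpha> - 1) < m"
    unfolding eventually_sequentially by blast
  show ?thesis
  proof (intro exI conjI allI impI)
    fix d :: nat and \<epsilon> :: real and T
    assume d: "d \<ge> max D 2" and "0 < \<epsilon> \<and> \<epsilon> < 1 / (\<alpha> * C) \<and> estimates_with d \<epsilon> T (renyi_entropy \<alpha> d)"
    then have \<epsilon>: "0 < \<epsilon>" "\<epsilon> < 1 / (\<alpha> * C)" "estimates_with d \<epsilon> T (renyi_entropy \<alpha> d)" by auto
    define x where "x = real d powr (1 / \<alpha> - 1)"
    have x0: "x > 0" using d by (simp add: x_def)
    have "x < m" using D d by (simp add: x_def)
    then have xs: "x \<le> 1 / 4" "x \<le> 1 / (2 * K)" "x \<le> 1 / 96\<^sup>2" by (auto simp: m_def)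
    have "sqrt x \<le> 1 / 96" using xs(3) real_sqrt_le_mono[OF xs(3)] by (simp add: real_sqrt_divide)
    then have x96: "1 / sqrt x \<ge> 96" using x0 by (simp add: field_simps)
    have Kx: "K * x \<le> 1 / 2" using xs(2) by (simp add: K_def field_simps)
    have a: "\<alpha> * (C * \<epsilon>) \<le> 1" using \<epsilon> \<alpha> C by (simp add: field_simps)
    have "1 * (C * \<epsilon>) \<le> \<alpha> * (C * \<epsilon>)" using \<alpha> \<epsilon> C by (intro mult_right_mono) auto
    then have b: "C * \<epsilon> \<le> 1" using a by simp
    have "1 / sqrt x / \<epsilon> / (192 * C) \<le> real T"
      using accuracy_lower_bound_aux[OF \<alpha>, of d \<epsilon> T] d xs Kx x96 \<epsilon> a b by (simp add: x_def C_def K_def)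
    moreover have "1 / sqrt x = real d powr (1/2 - 1/(2*\<alpha>))"
    proof -
      have "1 / sqrt x = real d powr (- ((1 / \<alpha> - 1) * (1 / 2)))"
        unfolding powr_minus_divide by (simp add: x_def powr_half_sqrt[symmetric] powr_powr)
      also have "- ((1 / \<alpha> - 1) * (1 / 2)) = 1/2 - 1/(2*\<alpha>)" using \<alpha> by (simp add: field_simps)
      finally show ?thesis .
    qed
    ultimately show "real T \<ge> 1 / (192 * C) * (real d powr (1/2 - 1/(2*\<alpha>)) / \<epsilon>)" by (simp add: mult.commute)
  qed (use C \<alpha> in auto)
qed

subsection \<open>Moment matching\<close>

text \<open>Lagrange interpolation at \<open>n + 1\<close> nodes reproduces the monomial of degree
  \<open>k < n\<close>. Its coefficient of degree \<open>n\<close> is 0, but computed from the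
  interpolation formula it is the divided difference.\<close>

lemma divided_difference_annihilates:
  fixes x :: "nat \<Rightarrow> real"
  assumes inj: "inj_on x {..n}" and k: "k < n"
  shows "(\<Sum>j\<le>n. x j ^ k / (\<Prod>i\<in>{..n} - {j}. x j - x i)) = 0"
proof -
  define q where "q = (\<lambda>j. \<Prod>i\<in>{..n} - {j}. [:- x i, 1:])"
  define W where "W = (\<lambda>j. \<Prod>i\<in>{..n} - {j}. x j - x i)"
  \<comment> \<open>The interpolation error: degree at most \<open>n\<close> with
    \<open>n + 1\<close> distinct roots, hence zero.\<close>
  define p where "p = (\<Sum>j\<le>n. smult (x j ^ k / W j) (q j)) - monom 1 k"
  have degq: "degree (q j) = n" "coeff (q j) n = 1" if "j \<le> n" for j
  proof -
    have "degree (q j) = (\<Sum>i\<in>{..n} - {j}. degree [:- x i, 1:])"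
      unfolding q_def by (rule degree_prod_sum_eq) auto
    also have "\<dots> = n" using that by simp
    finally show d: "degree (q j) = n" .
    have "lead_coeff (q j) = 1" unfolding q_def lead_coeff_prod by simp
    then show "coeff (q j) n = 1" using d by simp
  qed
  have W0: "W j \<noteq> 0" if "j \<le> n" for j
    using inj that by (auto simp: W_def inj_on_def)
  have "p = 0"
  proof (rule ccontr)
    assume "p \<noteq> 0"
    have "degree p \<le> n"
      unfolding p_def using k degq degree_monom_le[of "1::real" k]
      by (intro degree_diff_le degree_sum_le) (auto intro: order.trans[OF degree_smult_le])
    moreover have "x ` {..n} \<subseteq> {z. poly p z = 0}"
    proof
      fix z assume "z \<in> x ` {..n}"
      then obtain l where l: "l \<le> n" "z = x l" by auto
      have "poly (q j) (x l) = (if j = l then W l else 0)" if "j \<le> n" for j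
      proof (cases "j = l")
        case False
        then have "poly (q j) (x l) = 0" using l by (auto simp: q_def poly_prod)
        then show ?thesis using False by simp
      qed (simp add: q_def W_def poly_prod)
      then have "(\<Sum>j\<le>n. x j ^ k / W j * poly (q j) (x l)) = (\<Sum>j\<le>n. if j = l then x j ^ k / W j * W l else 0)"
        by (intro sum.cong) auto
      also have "\<dots> = x l ^ k" using l W0 by simp
      finally show "z \<in> {z. poly p z = 0}"
        using l by (simp add: p_def poly_sum poly_monom)
    qed
    then have "card (x ` {..n}) \<le> card {z. poly p z = 0}"
      using \<open>p \<noteq> 0\<close> by (intro card_mono poly_roots_finite) auto
    moreover have "card {z. poly p z = 0} \<le> degree p"
      using \<open>p \<noteq> 0\<close> by (rule card_poly_roots_bound)
    ultimately show False using inj by (simp add: card_image)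
  qed
  then have "0 = coeff p n" by simp
  also have "\<dots> = (\<Sum>j\<le>n. x j ^ k / W j * coeff (q j) n)"
    using k by (simp add: p_def coeff_sum)
  also have "\<dots> = (\<Sum>j\<le>n. x j ^ k / W j)"
    by (intro sum.cong) (auto simp: degq)
  finally show ?thesis by (simp add: W_def)
qed

text \<open>On nodes \<open>\<kappa> ^ j\<close> the denominator of the \<open>j\<close>-th weight
  has order \<open>\<kappa>\<close> to this sum. Only its quadratic dependence on \<open>j\<close>
  matters when terms are compared.\<close>

lemma sum_max_exponents:
  assumes "j \<le> n"
  shows "(\<Sum>i\<in>{..n} - {j}. real (max i j)) = (\<Sum>i\<in>{..n} - {0}. real i) + real j * (real j - 1) / 2"
proof -
  have "(\<Sum>i\<le>n. real (max i j)) = (\<Sum>i\<le>n. real i) + real j * (real j + 1) / 2"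
    using assms
  proof (induction j)
    case (Suc j)
    have "(\<Sum>i\<le>n. real (max i (Suc j))) = (\<Sum>i\<le>n. real (max i j) + (if i \<in> {..j} then 1 else 0))"
      by (intro sum.cong) (auto simp: max_def)
    also have "\<dots> = (\<Sum>i\<le>n. real (max i j)) + real (card ({..n} \<inter> {..j}))"
      by (simp add: sum.distrib sum.If_cases del: atMost_iff)
    also have "{..n} \<inter> {..j} = {..j}" using Suc by auto
    finally show ?case using Suc by (simp add: field_simps)
  qed simp
  moreover have "(\<Sum>i\<le>n. real (max i j)) = real j + (\<Sum>i\<in>{..n} - {j}. real (max i j))"
    using assms by (subst sum.remove[of _ j]) auto
  moreover have "(\<Sum>i\<le>n. real i) = 0 + (\<Sum>i\<in>{..n} - {0}. real i)"
    by (subst sum.remove[of _ 0]) auto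
  ultimately show ?thesis by (simp add: field_simps)
qed

text \<open>Since \<open>\<kappa> \<ge> 2\<close>, the larger power in each difference is at least
  twice the smaller, so each of the \<open>n\<close> factors equals its larger power up to a factor
  2.\<close>

lemma geometric_node_weight_bounds:
  fixes \<kappa> :: real
  assumes \<kappa>: "\<kappa> \<ge> 2" and j: "j \<le> n"
  defines "e \<equiv> (\<Sum>i\<in>{..n} - {j}. real (max i j))"
  shows "\<bar>\<Prod>i\<in>{..n} - {j}. \<kappa> ^ j - \<kappa> ^ i\<bar> \<le> \<kappa> powr e"
    and "\<kappa> powr e \<le> 2 ^ n * \<bar>\<Prod>i\<in>{..n} - {j}. \<kappa> ^ j - \<kappa> ^ i\<bar>"
proof -
  have e: "\<kappa> powr e = (\<Prod>i\<in>{..n} - {j}. \<kappa> ^ max i j)"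
    unfolding e_def using \<kappa> by (subst powr_sum) (auto simp: powr_realpow)
  have *: "\<bar>\<kappa> ^ a - \<kappa> ^ b\<bar> \<le> \<kappa> ^ max b a \<and> \<kappa> ^ max b a \<le> 2 * \<bar>\<kappa> ^ a - \<kappa> ^ b\<bar>" if "a < b" for a b :: nat
  proof -
    have "\<kappa> ^ Suc a \<le> \<kappa> ^ b" using that \<kappa> by (intro power_increasing) auto
    moreover have "2 * \<kappa> ^ a \<le> \<kappa> * \<kappa> ^ a" using \<kappa> by (intro mult_right_mono) auto
    ultimately have "2 * \<kappa> ^ a \<le> \<kappa> ^ b" by simp
    moreover have "0 < \<kappa> ^ a" using \<kappa> by simp
    ultimately show ?thesis using that by (simp add: max_def)
  qed
  have b: "\<bar>\<kappa> ^ j - \<kappa> ^ i\<bar> \<le> \<kappa> ^ max i j \<and> \<kappa> ^ max i j \<le> 2 * \<bar>\<kappa> ^ j - \<kappa> ^ i\<bar>" if "i \<noteq> j" for i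
    using *[of i j] *[of j i] that by (cases "i < j") (auto simp: abs_minus_commute max.commute)
  show "\<bar>\<Prod>i\<in>{..n} - {j}. \<kappa> ^ j - \<kappa> ^ i\<bar> \<le> \<kappa> powr e"
    unfolding e abs_prod using b by (intro prod_mono) auto
  have "\<kappa> powr e \<le> (\<Prod>i\<in>{..n} - {j}. 2 * \<bar>\<kappa> ^ j - \<kappa> ^ i\<bar>)"
    unfolding e using b \<kappa> by (intro prod_mono) auto
  also have "\<dots> = 2 ^ n * \<bar>\<Prod>i\<in>{..n} - {j}. \<kappa> ^ j - \<kappa> ^ i\<bar>"
    using j by (simp add: prod.distrib abs_prod)
  finally show "\<kappa> powr e \<le> 2 ^ n * \<bar>\<Prod>i\<in>{..n} - {j}. \<kappa> ^ j - \<kappa> ^ i\<bar>" .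
qed

text \<open>On widely spaced nodes \<open>\<kappa>\<^sup>j\<close> a single term of the divided difference of \<open>x \<mapsto> x powr \<alpha>\<close>, the one with
  \<open>j = \<lceil>\<alpha>\<rceil>\<close>, dominates all others. Its uniqueness is where non-integrality of \<open>\<alpha>\<close> enters.\<close>

lemma dominant_term:
  fixes \<alpha> R :: real
  assumes m: "real m - 1 < \<alpha>" "\<alpha> < real m" "m \<le> n" and R: "R > 0"
  obtains \<kappa> :: real where "\<kappa> \<ge> 2"
    "\<And>j. j \<le> n \<Longrightarrow> j \<noteq> m \<Longrightarrow> R * ((\<kappa> ^ j) powr \<alpha> / \<bar>\<Prod>i\<in>{..n} - {j}. \<kappa> ^ j - \<kappa> ^ i\<bar>)
        \<le> (\<kappa> ^ m) powr \<alpha> / \<bar>\<Prod>i\<in>{..n} - {m}. \<kappa> ^ m - \<kappa> ^ i\<bar>"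
proof -
  define \<eta> where "\<eta> = min (\<alpha> - (real m - 1)) (real m - \<alpha>)"
  have \<eta>: "\<eta> > 0" "\<eta> \<le> \<alpha> - (real m - 1)" "\<eta> \<le> real m - \<alpha>" using m by (auto simp: \<eta>_def)
  \<comment> \<open>Large enough that a gap \<open>\<eta>\<close> between exponents outweighs both
    the loss \<open>2 ^ n\<close> in the weights and the required ratio \<open>R\<close>.\<close>
  define \<kappa> where "\<kappa> = max 2 ((2 ^ n * R) powr (1 / \<eta>))"
  have \<kappa>: "\<kappa> \<ge> 2" by (simp add: \<kappa>_def)
  have \<kappa>R: "2 ^ n * R \<le> \<kappa> powr \<eta>"
  proof -
    have "2 ^ n * R = ((2 ^ n * R) powr (1 / \<eta>)) powr \<eta>" using \<eta> R by (simp add: powr_powr)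
    also have "\<dots> \<le> \<kappa> powr \<eta>" unfolding \<kappa>_def using \<eta> by (intro powr_mono2) auto
    finally show ?thesis .
  qed
  define W where "W = (\<lambda>j. \<bar>\<Prod>i\<in>{..n} - {j}. \<kappa> ^ j - \<kappa> ^ i\<bar>)"
  define e where "e = (\<lambda>j. \<Sum>i\<in>{..n} - {j}. real (max i j))"
  have up: "W j \<le> \<kappa> powr e j" and lo: "\<kappa> powr e j \<le> 2 ^ n * W j" if "j \<le> n" for j
    unfolding W_def e_def using geometric_node_weight_bounds[OF \<kappa> that] by auto
  have pos: "W j > 0" if "j \<le> n" for j
  proof -
    have "0 < \<kappa> powr e j" using \<kappa> by simp
    also note lo[OF that]
    finally show ?thesis by (simp add: zero_less_mult_iff)
  qed
  have "R * ((\<kappa> ^ j) powr \<alpha> / W j) \<le> (\<kappa> ^ m) powr \<alpha> / W m" if j: "j \<le> n" "j \<noteq> m" for j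
  proof -
    \<comment> \<open>The exponent of \<open>\<kappa>\<close> in the \<open>j\<close>-th term. It is
      a concave quadratic in \<open>j\<close>, and \<open>m - 1 < \<alpha> < m\<close> makes
      \<open>m\<close> its unique integer maximiser, with margin \<open>\<eta>\<close>.\<close>
    define \<phi> where "\<phi> = (\<lambda>j. real j * \<alpha> - e j)"
    have gap: "\<phi> j + \<eta> \<le> \<phi> m"
    proof -
      have ph: "\<phi> m - \<phi> j = (real m - real j) * (\<alpha> - (real m + real j - 1) / 2)"
        using sum_max_exponents[OF j(1)] sum_max_exponents[OF m(3)]
        by (simp add: \<phi>_def e_def field_simps)
      show ?thesis
      proof (cases "j < m")
        case True
        have "1 * \<eta> \<le> (real m - real j) * (\<alpha> - (real m + real j - 1) / 2)"
        proof (rule mult_mono)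
          have "real j + 1 \<le> real m" using True by simp
          then show "1 \<le> real m - real j" by simp
          show "\<eta> \<le> \<alpha> - (real m + real j - 1) / 2"
            using \<open>real j + 1 \<le> real m\<close> \<eta>(2) by (simp add: field_simps)
        qed (use True \<eta> in auto)
        then show ?thesis using ph by linarith
      next
        case False
        have "1 * \<eta> \<le> (real j - real m) * ((real m + real j - 1) / 2 - \<alpha>)"
        proof (rule mult_mono)
          have *: "real m + 1 \<le> real j" using False j(2) by simp
          then show "1 \<le> real j - real m" by simp
          show "\<eta> \<le> (real m + real j - 1) / 2 - \<alpha>"
            using * \<eta>(3) by (simp add: field_simps)
        qed (use False \<eta> in auto)
        also have "\<dots> = (real m - real j) * (\<alpha> - (real m + real j - 1) / 2)"
          by (simp add: field_simps)
        finally show ?thesis using ph by linarith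
      qed
    qed
    have pw: "(\<kappa> ^ i) powr \<alpha> = \<kappa> powr (real i * \<alpha>)" for i
      using \<kappa> by (simp add: powr_powr powr_realpow[symmetric])
    have "R * ((\<kappa> ^ j) powr \<alpha> / W j) \<le> R * ((\<kappa> ^ j) powr \<alpha> / (\<kappa> powr e j / 2 ^ n))"
      using lo[OF j(1)] pos[OF j(1)] R \<kappa>
      by (intro mult_left_mono divide_left_mono) (auto simp: field_simps)
    also have "\<dots> = (2 ^ n * R) * \<kappa> powr \<phi> j"
      by (simp add: pw \<phi>_def powr_diff)
    also have "\<dots> \<le> \<kappa> powr \<eta> * \<kappa> powr \<phi> j"
      using \<kappa>R by (intro mult_right_mono) auto
    also have "\<dots> \<le> \<kappa> powr \<phi> m"
      unfolding powr_add[symmetric] using gap \<kappa> by (intro powr_mono) auto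
    also have "\<dots> = (\<kappa> ^ m) powr \<alpha> / \<kappa> powr e m"
      by (simp add: pw \<phi>_def powr_diff)
    also have "\<dots> \<le> (\<kappa> ^ m) powr \<alpha> / W m"
      using \<kappa> up[OF m(3)] pos[OF m(3)] by (intro divide_left_mono) auto
    finally show ?thesis .
  qed
  with \<kappa> show ?thesis using that unfolding W_def by blast
qed

text \<open>The two laws are the normalised positive and negative parts of the divided-difference
  weights on geometric nodes. Annihilation of low powers gives equal moments, and the dominant node
  \<open>m\<close> is put into \<open>\<nu>1\<close>.\<close>

lemma moment_matching:
  fixes \<alpha> R :: real
  assumes \<alpha>: "\<alpha> > 0" "\<alpha> \<notin> \<int>" and n: "\<alpha> \<le> real n" and R: "R > 0"
  obtains t \<nu>0 \<nu>1 :: "nat \<Rightarrow> real" where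
    "\<And>j. 0 < t j" "\<And>j. j \<le> n \<Longrightarrow> t j \<le> 1"
    "\<And>j. 0 \<le> \<nu>0 j" "\<And>j. 0 \<le> \<nu>1 j" "(\<Sum>j\<le>n. \<nu>0 j) = 1" "(\<Sum>j\<le>n. \<nu>1 j) = 1"
    "\<And>k. k < n \<Longrightarrow> (\<Sum>j\<le>n. (\<nu>1 j - \<nu>0 j) * t j ^ k) = 0"
    "0 < (\<Sum>j\<le>n. \<nu>0 j * t j powr \<alpha>)"
    "R * (\<Sum>j\<le>n. \<nu>0 j * t j powr \<alpha>) \<le> (\<Sum>j\<le>n. \<nu>1 j * t j powr \<alpha>)"
proof -
  define m where "m = nat \<lceil>\<alpha>\<rceil>"
  have m_real: "real m = of_int \<lceil>\<alpha>\<rceil>" using \<alpha> by (simp add: m_def)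
  have "\<alpha> \<noteq> real m" using \<alpha>(2) by auto
  then have m: "real m - 1 < \<alpha>" "\<alpha> < real m" using ceiling_correct[of \<alpha>] m_real by linarith+
  have "real m < real n + 1" using m n by simp
  then have mn: "m \<le> n" by simp
  have n0: "n > 0" using n \<alpha> by (cases n) auto
  \<comment> \<open>The extra factor \<open>n + 1\<close> lets the single term at \<open>m\<close>
    beat \<open>R\<close> times the sum of all the others.\<close>
  have "0 < R * (real n + 1)" using R by simp
  then obtain \<kappa> where \<kappa>: "\<kappa> \<ge> 2" and
    dom: "\<And>j. j \<le> n \<Longrightarrow> j \<noteq> m \<Longrightarrow> R * (real n + 1) * ((\<kappa> ^ j) powr \<alpha> / \<bar>\<Prod>i\<in>{..n} - {j}. \<kappa> ^ j - \<kappa> ^ i\<bar>)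
        \<le> (\<kappa> ^ m) powr \<alpha> / \<bar>\<Prod>i\<in>{..n} - {m}. \<kappa> ^ m - \<kappa> ^ i\<bar>"
    using dominant_term[OF m mn] by blast
  have inj: "inj_on (\<lambda>j. \<kappa> ^ j) {..n}"
    using \<kappa> by (auto simp: inj_on_def)
  define W where "W = (\<lambda>j. 1 / (\<Prod>i\<in>{..n} - {j}. \<kappa> ^ j - \<kappa> ^ i))"
  have W0: "W j \<noteq> 0" if "j \<le> n" for j
    using \<kappa> that by (auto simp: W_def)
  have ann: "(\<Sum>j\<le>n. W j * (\<kappa> ^ j) ^ k) = 0" if "k < n" for k
    using divided_difference_annihilates[OF inj that] by (simp add: W_def)
  define t where "t = (\<lambda>j. \<kappa> ^ j / \<kappa> ^ n)"
  \<comment> \<open>Orients the signed weights so that node \<open>m\<close> belongs to the positive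
    part.\<close>
  define \<sigma> where "\<sigma> = sgn (W m)"
  have \<sigma>: "\<bar>\<sigma>\<bar> = 1" "\<sigma> * W m = \<bar>W m\<bar>" using W0[OF mn] by (auto simp: \<sigma>_def sgn_if)
  define M where "M = (\<Sum>j\<le>n. max 0 (\<sigma> * W j))"
  have dec: "max 0 (\<sigma> * W j) - max 0 (- (\<sigma> * W j)) = \<sigma> * W j" for j by auto
  \<comment> \<open>The zeroth moment vanishes because \<open>n > 0\<close>, so both parts have the
    same mass and one constant normalises both.\<close>
  have M': "(\<Sum>j\<le>n. max 0 (- (\<sigma> * W j))) = M"
  proof -
    have "M - (\<Sum>j\<le>n. max 0 (- (\<sigma> * W j))) = \<sigma> * (\<Sum>j\<le>n. W j)"
      unfolding M_def sum_subtractf[symmetric] dec sum_distrib_left ..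
    then show ?thesis using ann[OF n0] by simp
  qed
  have M0: "M > 0"
  proof -
    have "0 < max 0 (\<sigma> * W m)" using \<sigma> W0[OF mn] by simp
    also have "\<dots> \<le> M" unfolding M_def using mn by (intro member_le_sum) auto
    finally show ?thesis .
  qed
  define \<nu>1 \<nu>0 where "\<nu>1 = (\<lambda>j. max 0 (\<sigma> * W j) / M)" and "\<nu>0 = (\<lambda>j. max 0 (- (\<sigma> * W j)) / M)"
  have t0: "t j > 0" for j using \<kappa> by (simp add: t_def)
  have tp: "t j powr \<alpha> = (\<kappa> ^ j) powr \<alpha> / (\<kappa> ^ n) powr \<alpha>" for j
    unfolding t_def by (rule powr_divide)
  define L where "L = M * (\<kappa> ^ n) powr \<alpha>"
  have L: "L > 0" using M0 \<kappa> by (simp add: L_def)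
  define D where "D = \<bar>W m\<bar> * (\<kappa> ^ m) powr \<alpha> / L"
  have D0: "D \<ge> 0" using L by (simp add: D_def)
  have sums: "(\<Sum>j\<le>n. \<nu>0 j) = 1" "(\<Sum>j\<le>n. \<nu>1 j) = 1"
    using M0 M' by (simp_all add: \<nu>0_def \<nu>1_def M_def flip: sum_divide_distrib)
  have nn: "0 \<le> \<nu>0 j" "0 \<le> \<nu>1 j" for j using M0 by (simp_all add: \<nu>0_def \<nu>1_def)
  have E1: "D \<le> (\<Sum>j\<le>n. \<nu>1 j * t j powr \<alpha>)"
  proof -
    have "D = \<nu>1 m * t m powr \<alpha>" by (simp add: D_def \<nu>1_def tp \<sigma> L_def)
    also have "\<dots> \<le> (\<Sum>j\<le>n. \<nu>1 j * t j powr \<alpha>)"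
      using mn nn by (intro member_le_sum) auto
    finally show ?thesis .
  qed
  have E0: "R * (\<Sum>j\<le>n. \<nu>0 j * t j powr \<alpha>) \<le> D"
  proof -
    have "R * (real n + 1) * (\<nu>0 j * t j powr \<alpha>) \<le> D" if "j \<le> n" for j
    proof (cases "j = m")
      case True
      then show ?thesis using D0 \<sigma> by (simp add: \<nu>0_def)
    next
      case False
      have "\<nu>0 j * t j powr \<alpha> \<le> (\<kappa> ^ j) powr \<alpha> * \<bar>W j\<bar> / L"
      proof -
        have "max 0 (- (\<sigma> * W j)) \<le> \<bar>W j\<bar>" using \<sigma>(1) by (auto simp: abs_if split: if_splits)
        then have "(\<kappa> ^ j) powr \<alpha> * max 0 (- (\<sigma> * W j)) / L \<le> (\<kappa> ^ j) powr \<alpha> * \<bar>W j\<bar> / L"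
          using L by (intro divide_right_mono mult_left_mono) auto
        then show ?thesis by (simp add: \<nu>0_def tp L_def mult.commute)
      qed
      then have "R * (real n + 1) * (\<nu>0 j * t j powr \<alpha>) \<le> R * (real n + 1) * ((\<kappa> ^ j) powr \<alpha> * \<bar>W j\<bar> / L)"
        using R by (intro mult_left_mono) auto
      also have "\<dots> = (R * (real n + 1) * ((\<kappa> ^ j) powr \<alpha> / \<bar>\<Prod>i\<in>{..n} - {j}. \<kappa> ^ j - \<kappa> ^ i\<bar>)) / L"
        by (simp add: W_def)
      also have "\<dots> \<le> ((\<kappa> ^ m) powr \<alpha> / \<bar>\<Prod>i\<in>{..n} - {m}. \<kappa> ^ m - \<kappa> ^ i\<bar>) / L"
        using dom[OF that False] L by (intro divide_right_mono) auto
      also have "\<dots> = D" by (simp add: D_def W_def)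
      finally show ?thesis .
    qed
    then have "(\<Sum>j\<le>n. R * (real n + 1) * (\<nu>0 j * t j powr \<alpha>)) \<le> (\<Sum>j\<le>n. D)"
      by (intro sum_mono) auto
    also have "(\<Sum>j\<le>n. D) = (real n + 1) * D" by simp
    finally have "(real n + 1) * (R * (\<Sum>j\<le>n. \<nu>0 j * t j powr \<alpha>)) \<le> (real n + 1) * D"
      unfolding sum_distrib_left[symmetric] by (simp only: mult_ac)
    then show ?thesis by (rule mult_left_le_imp_le) simp
  qed
  show ?thesis
  proof (rule that[of t \<nu>0 \<nu>1])
    show "t j \<le> 1" if "j \<le> n" for j
      using that \<kappa> by (simp add: t_def power_increasing)
    show "(\<Sum>j\<le>n. (\<nu>1 j - \<nu>0 j) * t j ^ k) = 0" if "k < n" for k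
    proof -
      have "\<nu>1 j - \<nu>0 j = \<sigma> * W j / M" for j
        unfolding \<nu>1_def \<nu>0_def diff_divide_distrib[symmetric] dec ..
      then have "(\<Sum>j\<le>n. (\<nu>1 j - \<nu>0 j) * t j ^ k) = (\<Sum>j\<le>n. (\<sigma> / M / (\<kappa> ^ n) ^ k) * (W j * (\<kappa> ^ j) ^ k))"
        by (simp add: t_def power_divide mult_ac)
      also have "\<dots> = 0" unfolding sum_distrib_left[symmetric] ann[OF that] by simp
      finally show ?thesis .
    qed
    show "0 < (\<Sum>j\<le>n. \<nu>0 j * t j powr \<alpha>)"
    proof (rule ccontr)
      assume "\<not> 0 < (\<Sum>j\<le>n. \<nu>0 j * t j powr \<alpha>)"
      moreover have "0 \<le> (\<Sum>j\<le>n. \<nu>0 j * t j powr \<alpha>)" using nn by (intro sum_nonneg) auto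
      ultimately have "(\<Sum>j\<le>n. \<nu>0 j * t j powr \<alpha>) = 0" by simp
      then have "\<forall>j\<in>{..n}. \<nu>0 j * t j powr \<alpha> = 0"
        using nn by (subst (asm) sum_nonneg_eq_0_iff) auto
      then have "\<forall>j\<in>{..n}. \<nu>0 j = 0" using t0 by (metis less_irrefl mult_eq_0_iff powr_gt_zero)
      then show False using sums(1) by simp
    qed
    show "R * (\<Sum>j\<le>n. \<nu>0 j * t j powr \<alpha>) \<le> (\<Sum>j\<le>n. \<nu>1 j * t j powr \<alpha>)"
      using E0 E1 by linarith
  qed (use t0 nn sums in auto)
qed

subsection \<open>Averages over independent letters\<close>

text \<open>Expectation of \<open>F\<close> over \<open>n\<close> independent letters with law
  \<open>w\<close>, written as nested finite sums. Positions from \<open>n\<close> on keep the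
  default \<open>undefined\<close>.\<close>

primrec average :: "'b set \<Rightarrow> ('b \<Rightarrow> real) \<Rightarrow> nat \<Rightarrow> ((nat \<Rightarrow> 'b) \<Rightarrow> real) \<Rightarrow> real" where
  "average S w 0 F = F (\<lambda>_. undefined)"
| "average S w (Suc n) F = average S w n (\<lambda>x. \<Sum>j\<in>S. w j * F (x(n := j)))"

locale weights =
  fixes S :: "'b set" and w :: "'b \<Rightarrow> real"
  assumes nonneg: "\<And>j. j \<in> S \<Longrightarrow> 0 \<le> w j" and total: "(\<Sum>j\<in>S. w j) = 1"
begin

lemma average_mono:
  assumes "\<And>x. (\<And>k. k < n \<Longrightarrow> x k \<in> S) \<Longrightarrow> F x \<le> G x"
  shows "average S w n F \<le> average S w n G"
  using assms
proof (induction n arbitrary: F G)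
  case (Suc n)
  show ?case
    unfolding average.simps
    by (intro Suc.IH sum_mono mult_left_mono Suc.prems nonneg) (auto simp: less_Suc_eq)
qed simp

lemma average_add: "average S w n (\<lambda>x. F x + G x) = average S w n F + average S w n G"
proof (induction n arbitrary: F G)
  case (Suc n)
  show ?case unfolding average.simps Suc[symmetric] by (simp add: algebra_simps sum.distrib)
qed simp

lemma average_cmult: "average S w n (\<lambda>x. c * F x) = c * average S w n F"
proof (induction n arbitrary: F)
  case (Suc n)
  show ?case unfolding average.simps Suc[symmetric] by (simp add: sum_distrib_left mult_ac)
qed simp

lemma average_const: "average S w n (\<lambda>x. c) = c"
  by (induction n) (simp_all add: total flip: sum_distrib_right)

lemma average_diff: "average S w n (\<lambda>x. F x - G x) = average S w n F - average S w n G"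
  using average_add[of n F "\<lambda>x. (-1) * G x"] unfolding average_cmult by simp

lemma average_sum:
  "average S w n (\<lambda>x. \<Sum>i<n. g (x i)) = real n * (\<Sum>j\<in>S. w j * g j)"
proof (induction n)
  case (Suc n)
  have "(\<Sum>j\<in>S. w j * (\<Sum>i<Suc n. g ((x(n := j)) i))) = (\<Sum>i<n. g (x i)) + (\<Sum>j\<in>S. w j * g j)" for x
    by (simp add: distrib_left sum.distrib total flip: sum_distrib_right)
  then show ?case
    by (simp only: average.simps average_add Suc average_const) (simp add: algebra_simps)
qed simp

text \<open>Variance of a sum of independent centred letters: the cross term with a new letter
  vanishes because \<open>h\<close> has mean 0.\<close>

lemma average_sum_square:
  assumes "(\<Sum>j\<in>S. w j * h j) = 0"
  shows "average S w n (\<lambda>x. (\<Sum>i<n. h (x i))\<^sup>2) = real n * (\<Sum>j\<in>S. w j * (h j)\<^sup>2)"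
proof (induction n)
  case (Suc n)
  have "(\<Sum>j\<in>S. w j * (\<Sum>i<Suc n. h ((x(n := j)) i))\<^sup>2)
      = (\<Sum>i<n. h (x i))\<^sup>2 + (\<Sum>j\<in>S. w j * (h j)\<^sup>2)" for x
  proof -
    define s where "s = (\<Sum>i<n. h (x i))"
    have "(\<Sum>j\<in>S. w j * (\<Sum>i<Suc n. h ((x(n := j)) i))\<^sup>2) = (\<Sum>j\<in>S. w j * (s + h j)\<^sup>2)"
      by (simp add: s_def)
    also have "\<dots> = (\<Sum>j\<in>S. w j * s\<^sup>2 + 2 * s * (w j * h j) + w j * (h j)\<^sup>2)"
      by (simp add: power2_eq_square algebra_simps)
    also have "\<dots> = (\<Sum>j\<in>S. w j) * s\<^sup>2 + 2 * s * (\<Sum>j\<in>S. w j * h j) + (\<Sum>j\<in>S. w j * (h j)\<^sup>2)"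
      by (simp add: sum.distrib sum_distrib_left sum_distrib_right)
    finally show ?thesis by (simp add: total assms s_def)
  qed
  then show ?case
    by (simp only: average.simps average_add Suc average_const) (simp add: algebra_simps)
qed simp

end

text \<open>Hybrid argument: the letters change their law one at a time, each at cost at most
  \<open>\<delta>\<close> for every fixed choice of the others.\<close>

lemma average_hybrid:
  assumes w0: "weights S w0" and w1: "weights S w1"
    and step: "\<And>i x. i < n \<Longrightarrow> (\<And>k. k < n \<Longrightarrow> k \<noteq> i \<Longrightarrow> x k \<in> S) \<Longrightarrow>
        \<bar>\<Sum>j\<in>S. (w1 j - w0 j) * F (x(i := j))\<bar> \<le> \<delta>"
  shows "\<bar>average S w1 n F - average S w0 n F\<bar> \<le> real n * \<delta>"
  using step
proof (induction n arbitrary: F)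
  case (Suc n)
  \<comment> \<open>The first \<open>n\<close> letters are exchanged while the last follows
    \<open>w1\<close>; then the last is exchanged while the others follow \<open>w0\<close>.\<close>
  define F1 where "F1 = (\<lambda>x. \<Sum>j\<in>S. w1 j * F (x(n := j)))"
  define F0 where "F0 = (\<lambda>x. \<Sum>j\<in>S. w0 j * F (x(n := j)))"
  have "\<bar>average S w1 n F1 - average S w0 n F1\<bar> \<le> real n * \<delta>"
  proof (rule Suc.IH)
    fix i x assume i: "i < n" and x: "\<And>k. k < n \<Longrightarrow> k \<noteq> i \<Longrightarrow> x k \<in> S"
    have "(\<Sum>j\<in>S. (w1 j - w0 j) * F1 (x(i := j)))
        = (\<Sum>j\<in>S. \<Sum>l\<in>S. w1 l * ((w1 j - w0 j) * F ((x(n := l))(i := j))))"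
      using i by (simp add: F1_def sum_distrib_left fun_upd_twist mult_ac)
    also have "\<dots> = (\<Sum>l\<in>S. w1 l * (\<Sum>j\<in>S. (w1 j - w0 j) * F ((x(n := l))(i := j))))"
      by (subst sum.swap) (simp add: sum_distrib_left)
    also have "\<bar>\<dots>\<bar> \<le> (\<Sum>l\<in>S. \<bar>w1 l * (\<Sum>j\<in>S. (w1 j - w0 j) * F ((x(n := l))(i := j)))\<bar>)"
      by (rule sum_abs)
    also have "\<dots> \<le> (\<Sum>l\<in>S. w1 l * \<delta>)"
    proof (rule sum_mono)
      fix l assume l: "l \<in> S"
      have "\<bar>\<Sum>j\<in>S. (w1 j - w0 j) * F ((x(n := l))(i := j))\<bar> \<le> \<delta>"
        by (rule Suc.prems) (use i x l in \<open>auto simp: less_Suc_eq\<close>)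
      then show "\<bar>w1 l * (\<Sum>j\<in>S. (w1 j - w0 j) * F ((x(n := l))(i := j)))\<bar> \<le> w1 l * \<delta>"
        using weights.nonneg[OF w1 l] by (simp add: abs_mult mult_left_mono)
    qed
    also have "\<dots> = \<delta>" by (simp add: weights.total[OF w1] flip: sum_distrib_right)
    finally show "\<bar>\<Sum>j\<in>S. (w1 j - w0 j) * F1 (x(i := j))\<bar> \<le> \<delta>" .
  qed
  moreover have "\<bar>average S w0 n F1 - average S w0 n F0\<bar> \<le> \<delta>"
  proof -
    have d: "\<bar>F1 x - F0 x\<bar> \<le> \<delta>" if "\<And>k. k < n \<Longrightarrow> x k \<in> S" for x
    proof -
      have "\<bar>\<Sum>j\<in>S. (w1 j - w0 j) * F (x(n := j))\<bar> \<le> \<delta>"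
        by (rule Suc.prems) (use that in \<open>auto simp: less_Suc_eq\<close>)
      then show ?thesis by (simp add: F1_def F0_def left_diff_distrib sum_subtractf)
    qed
    have "average S w0 n (\<lambda>x. F1 x - F0 x) \<le> average S w0 n (\<lambda>x. \<delta>)"
      by (rule weights.average_mono[OF w0]) (use d in \<open>simp add: abs_le_iff\<close>)
    moreover have "average S w0 n (\<lambda>x. - \<delta>) \<le> average S w0 n (\<lambda>x. F1 x - F0 x)"
    proof (rule weights.average_mono[OF w0])
      fix x assume x: "\<And>k. k < n \<Longrightarrow> x k \<in> S"
      have "\<bar>F1 x - F0 x\<bar> \<le> \<delta>" by (rule d) (rule x)
      then show "- \<delta> \<le> F1 x - F0 x" by linarith
    qed
    ultimately show ?thesis
      by (simp add: weights.average_const[OF w0] weights.average_diff[OF w0])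
  qed
  ultimately show ?case by (simp add: F1_def F0_def algebra_simps)
qed simp

subsection \<open>Dependence on the dimension\<close>

text \<open>A letter \<open>(j, s)\<close> stands for an element of probability \<open>t j / (2 N)\<close> whose amplitude has sign \<open>s\<close>.
  Averaging over the sign makes acceptance probabilities polynomial in the probability itself.\<close>

definition signed_weight :: "(nat \<Rightarrow> real) \<Rightarrow> nat \<times> real \<Rightarrow> real" where
  "signed_weight \<nu> p = \<nu> (fst p) / 2"

definition signed_letters :: "nat \<Rightarrow> (nat \<times> real) set" where
  "signed_letters n = {..n} \<times> {-1, 1}"

lemma sum_signed_letters:
  "(\<Sum>p\<in>signed_letters n. signed_weight \<nu> p * g p) = (\<Sum>j\<le>n. \<nu> j * (\<Sum>s\<in>{-1, 1}. g (j, s) / 2))"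
  unfolding signed_letters_def signed_weight_def sum.cartesian_product' by (simp add: distrib_left)

lemma weights_signed:
  assumes "\<And>j. 0 \<le> \<nu> j" "(\<Sum>j\<le>n. \<nu> j) = 1"
  shows "weights (signed_letters n) (signed_weight \<nu>)"
proof
  show "(\<Sum>p\<in>signed_letters n. signed_weight \<nu> p) = 1"
    using sum_signed_letters[where \<nu> = \<nu> and n = n and g = "\<lambda>_. 1"] assms(2) by simp
qed (use assms in \<open>simp add: signed_weight_def\<close>)

section \<open>The randomised hard family and its acceptance probabilities\<close>

locale hard_family =
  fixes \<alpha> :: real and t :: "nat \<Rightarrow> real" and n N d :: nat
  assumes \<alpha>: "\<alpha> > 1" and t_pos: "\<And>j. 0 < t j" and t_le: "\<And>j. j \<le> n \<Longrightarrow> t j \<le> 1"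
    and N: "0 < N" "N < d"
begin

definition y :: "nat \<Rightarrow> real" where "y j = t j / (2 * real N)"

definition amps :: "(nat \<Rightarrow> nat \<times> real) \<Rightarrow> nat \<Rightarrow> real" where
  "amps x i = snd (x i) * sqrt (y (fst (x i)))"

definition mass :: "(nat \<Rightarrow> nat \<times> real) \<Rightarrow> real" where
  "mass x = (\<Sum>i<N. y (fst (x i)))"

definition state :: "(nat \<Rightarrow> nat \<times> real) \<Rightarrow> real \<Rightarrow> nat \<Rightarrow> real" where
  "state x \<tau> = inst d N (amps x) (\<tau> * sqrt (1 - mass x))"

text \<open>Averaging over the sign \<open>\<tau>\<close> of the common amplitude, together with the
  random sign of one letter, yields the four sign patterns of \<open>threshold_test\<close>.\<close>

definition acc :: "((nat \<Rightarrow> real) \<Rightarrow> real) \<Rightarrow> (nat \<Rightarrow> nat \<times> real) \<Rightarrow> real" where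
  "acc P x = (\<Sum>\<tau>\<in>{-1, 1}. P (state x \<tau>) / 2)"

definition tsum :: "(nat \<Rightarrow> nat \<times> real) \<Rightarrow> real" where
  "tsum x = (\<Sum>i<N. t (fst (x i)) powr \<alpha>)"

lemma y_pos: "0 < y j" using t_pos N by (simp add: y_def)

lemma y_le: "y j \<le> 1 / (2 * real N)" if "j \<le> n"
  using t_le[OF that] N by (simp add: y_def divide_right_mono)

lemma sum_y_le:
  assumes "\<And>k. k \<in> A \<Longrightarrow> x k \<in> signed_letters n" "A \<subseteq> {..<N}"
  shows "(\<Sum>k\<in>A. y (fst (x k))) \<le> 1 / 2"
proof -
  have "card A \<le> N" using card_mono[OF _ assms(2)] by simp
  have "(\<Sum>k\<in>A. y (fst (x k))) \<le> (\<Sum>k\<in>A. 1 / (2 * real N))"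
    using assms(1) by (intro sum_mono y_le) (simp add: signed_letters_def mem_Times_iff)
  also have "\<dots> \<le> 1 / 2" using \<open>card A \<le> N\<close> N by (simp add: field_simps)
  finally show ?thesis .
qed

lemma amps_square: "x i \<in> signed_letters n \<Longrightarrow> (amps x i)\<^sup>2 = y (fst (x i))"
  using y_pos[of "fst (x i)"] by (auto simp: amps_def signed_letters_def power_mult_distrib)

lemma state_facts:
  assumes x: "\<forall>k<N. x k \<in> signed_letters n" and \<tau>: "\<tau> \<in> {-1, 1}"
  shows "(\<Sum>i<d. (state x \<tau> i)\<^sup>2) = 1"
    and "renyi_entropy \<alpha> d (\<lambda>i. (state x \<tau> i)\<^sup>2) = ln ((2 * real N) powr (- \<alpha>) * tsum x
       + (1 - mass x) powr \<alpha> * real (d - N) powr (1 - \<alpha>)) / (1 - \<alpha>)"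
    and "mass x \<le> 1 / 2" "0 \<le> mass x"
proof -
  show m: "mass x \<le> 1 / 2" unfolding mass_def using x by (intro sum_y_le) auto
  show "0 \<le> mass x" unfolding mass_def using y_pos by (intro sum_nonneg) (auto intro: less_imp_le)
  have \<tau>2: "(\<tau> * sqrt (1 - mass x))\<^sup>2 = 1 - mass x" using \<tau> m by (auto simp: power_mult_distrib)
  have sq: "(\<Sum>i<N. g ((amps x i)\<^sup>2)) = (\<Sum>i<N. g (y (fst (x i))))" for g :: "real \<Rightarrow> real"
    using x by (intro sum.cong) (auto simp: amps_square)
  show "(\<Sum>i<d. (state x \<tau> i)\<^sup>2) = 1"
    unfolding state_def inst_norm[OF N(2)] \<tau>2 using sq[of "\<lambda>z. z"] by (simp add: mass_def)
  have "(\<Sum>i<N. (amps x i)\<^sup>2 powr \<alpha>) = (2 * real N) powr (- \<alpha>) * tsum x"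
    unfolding sq[of "\<lambda>z. z powr \<alpha>"] y_def tsum_def
    by (simp only: powr_divide powr_minus_divide sum_distrib_left times_divide_eq_left mult_1)
  then show "renyi_entropy \<alpha> d (\<lambda>i. (state x \<tau> i)\<^sup>2) = ln ((2 * real N) powr (- \<alpha>) * tsum x
       + (1 - mass x) powr \<alpha> * real (d - N) powr (1 - \<alpha>)) / (1 - \<alpha>)"
    unfolding state_def renyi_entropy_inst[OF N(2)] \<tau>2 by simp
qed

lemma tsum_pos: "0 < tsum x"
proof -
  have "0 < t j powr \<alpha>" for j using t_pos[of j] by simp
  then show ?thesis unfolding tsum_def using N by (intro sum_pos) auto
qed

text \<open>Isolates the dependence on letter \<open>i\<close>: the constant \<open>c\<close>
  involves only the other letters, so it is the same for every replacement
  \<open>(j, s)\<close>.\<close>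

lemma acc_replace:
  assumes i: "i < N" and x: "\<forall>k<N. k \<noteq> i \<longrightarrow> x k \<in> signed_letters n"
  defines "c \<equiv> 1 - (\<Sum>k\<in>{..<N} - {i}. (amps x k)\<^sup>2)"
  shows "acc P (x(i := (j, s))) = (\<Sum>\<tau>\<in>{-1, 1}.
      P (inst d N ((amps x)(i := s * sqrt (y j))) (\<tau> * sqrt (c - y j))) / 2)"
    and "1 / 2 \<le> c"
proof -
  have c: "c = 1 - (\<Sum>k\<in>{..<N} - {i}. y (fst (x k)))"
    unfolding c_def using x by (simp add: amps_square)
  show "1 / 2 \<le> c" unfolding c using sum_y_le[of "{..<N} - {i}" x] x by auto
  have "mass (x(i := (j, s))) = y j + (\<Sum>k\<in>{..<N} - {i}. y (fst (x k)))"
    unfolding mass_def using i by (subst sum.remove[of _ i]) (auto intro!: sum.cong)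
  then have "1 - mass (x(i := (j, s))) = c - y j" by (simp add: c)
  moreover have "amps (x(i := (j, s))) = (amps x)(i := s * sqrt (y j))"
    by (auto simp: amps_def fun_eq_iff)
  ultimately show "acc P (x(i := (j, s))) = (\<Sum>\<tau>\<in>{-1, 1}.
      P (inst d N ((amps x)(i := s * sqrt (y j))) (\<tau> * sqrt (c - y j))) / 2)"
    by (simp add: acc_def state_def)
qed

text \<open>After sign averaging, the acceptance probability depends on letter \<open>i\<close>
  through a polynomial of degree at most \<open>q\<close> in \<open>y j\<close>, and the difference
  of the two laws annihilates its terms of order below \<open>n\<close>.\<close>

lemma hybrid_step:
  fixes P :: "(nat \<Rightarrow> real) \<Rightarrow> real"
  assumes P01: "\<And>amp. (\<Sum>i<d. (amp i)\<^sup>2) = 1 \<Longrightarrow> 0 \<le> P amp \<and> P amp \<le> 1"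
    and Ppoly: "\<And>c \<gamma> \<alpha> \<beta>. \<exists>G :: complex poly. degree G \<le> q \<and> (\<forall>y. 0 \<le> y \<and> y \<le> c \<longrightarrow>
       poly G (of_real y) = of_real (\<Sum>s\<in>{-1, 1}. \<Sum>t\<in>{-1, 1}.
         P (\<lambda>i. \<gamma> i + \<alpha> i * (s * sqrt y) + \<beta> i * (t * sqrt (c - y))) / 4))"
    and q: "q > 0" and n: "n > 0" and small: "16 * (real q)\<^sup>2 / real N \<le> 1 / 2"
    and \<nu>: "\<And>j. 0 \<le> \<nu>0 j" "\<And>j. 0 \<le> \<nu>1 j" "(\<Sum>j\<le>n. \<nu>0 j) = 1" "(\<Sum>j\<le>n. \<nu>1 j) = 1"
    and moments: "\<And>k. k < n \<Longrightarrow> (\<Sum>j\<le>n. (\<nu>1 j - \<nu>0 j) * t j ^ k) = 0"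
    and i: "i < N" and x: "\<forall>k<N. k \<noteq> i \<longrightarrow> x k \<in> signed_letters n"
  shows "\<bar>\<Sum>p\<in>signed_letters n. (signed_weight \<nu>1 p - signed_weight \<nu>0 p) * acc P (x(i := p))\<bar>
     \<le> 8 * (16 * (real q)\<^sup>2 / real N) ^ n"
proof -
  define c where "c = 1 - (\<Sum>k\<in>{..<N} - {i}. (amps x k)\<^sup>2)"
  have c: "1 / 2 \<le> c" using acc_replace(2)[OF i x] by (simp add: c_def)
  have yc: "y j \<le> c" if "j \<le> n" for j
  proof -
    have "1 / (2 * real N) \<le> 1 / 2" using N by (simp add: field_simps)
    then show ?thesis using y_le[OF that] c by linarith
  qed
  show ?thesis
  proof (rule inst_acceptance_poly[where P = P and a = "amps x", OF P01 Ppoly i N(2) c_def])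
    fix G :: "complex poly"
    assume deg: "degree G \<le> q"
      and G: "\<And>y. 0 \<le> y \<Longrightarrow> y \<le> c \<Longrightarrow> poly G (of_real y) = of_real (\<Sum>s\<in>{-1, 1}. \<Sum>t\<in>{-1, 1}.
         P (inst d N ((amps x)(i := s * sqrt y)) (t * sqrt (c - y))) / 4)"
      and G1: "\<And>y. 0 \<le> y \<Longrightarrow> y \<le> c \<Longrightarrow> cmod (poly G (of_real y)) \<le> 1"
    define \<delta> where "\<delta> = (\<lambda>j. \<nu>1 j - \<nu>0 j)"
    have "(\<Sum>p\<in>signed_letters n. (signed_weight \<nu>1 p - signed_weight \<nu>0 p) * acc P (x(i := p)))
        = (\<Sum>p\<in>signed_letters n. signed_weight \<delta> p * acc P (x(i := p)))"
      by (simp add: signed_weight_def \<delta>_def diff_divide_distrib)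
    also have "\<dots> = (\<Sum>j\<le>n. \<delta> j * (\<Sum>s\<in>{-1, 1}. acc P (x(i := (j, s))) / 2))"
      by (rule sum_signed_letters)
    also have "\<dots> = (\<Sum>j\<le>n. \<delta> j * (\<Sum>s\<in>{-1, 1}. \<Sum>\<tau>\<in>{-1, 1}.
         P (inst d N ((amps x)(i := s * sqrt (y j))) (\<tau> * sqrt (c - y j))) / 4))"
    proof -
      have "acc P (x(i := (j, s))) / 2 = (\<Sum>\<tau>\<in>{-1, 1}.
         P (inst d N ((amps x)(i := s * sqrt (y j))) (\<tau> * sqrt (c - y j))) / 4)" for j s
        unfolding acc_replace(1)[OF i x, where P = P] c_def sum_divide_distrib by simp
      then show ?thesis by (simp only:)
    qed
    also have "complex_of_real \<dots> = (\<Sum>j\<le>n. of_real (\<delta> j) * poly G (of_real (y j)))"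
      unfolding of_real_sum[of _ "{..n}"] of_real_mult[of "\<delta> _"]
      using G yc y_pos by (intro sum.cong refl arg_cong2[where f = "(*)"]) (simp_all add: less_imp_le)
    finally have "\<bar>\<Sum>p\<in>signed_letters n. (signed_weight \<nu>1 p - signed_weight \<nu>0 p) * acc P (x(i := p))\<bar>
       = cmod (\<Sum>j\<le>n. of_real (\<delta> j) * poly G (of_real (y j)))"
      by (metis norm_of_real real_norm_def)
    \<comment> \<open>Here \<open>Y = 1 / (2 * N)\<close>, and the annihilated orders end at
      \<open>L = n - 1\<close>. With \<open>c \<ge> 1 / 2\<close> the ratio is at most
      \<open>16 * q\<^sup>2 / N\<close>.\<close>
    also have "\<dots> \<le> 8 * (1 / (2 * real N) * (16 * (real q)\<^sup>2 / c)) ^ Suc (n - 1)"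
    proof (rule moment_functional_bound[OF deg q _ G1])
      show "c > 0" using c by simp
      show "0 \<le> y j \<and> y j \<le> 1 / (2 * real N)" if "j \<in> {..n}" for j
        using y_le[of j] y_pos[of j] that by simp
      have "(\<Sum>j\<le>n. \<bar>\<delta> j\<bar>) \<le> (\<Sum>j\<le>n. \<nu>1 j + \<nu>0 j)"
        using \<nu>(1,2) by (intro sum_mono) (simp add: \<delta>_def abs_le_iff add_increasing)
      then show "(\<Sum>j\<le>n. \<bar>\<delta> j\<bar>) \<le> 2" using \<nu>(3,4) by (simp add: sum.distrib)
      show "(\<Sum>j\<le>n. \<delta> j * y j ^ k) = 0" if "k \<le> n - 1" for k
      proof -
        have "(\<Sum>j\<le>n. \<delta> j * y j ^ k) = (\<Sum>j\<le>n. (\<nu>1 j - \<nu>0 j) * t j ^ k) / (2 * real N) ^ k"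
          by (simp add: \<delta>_def y_def power_divide sum_divide_distrib)
        also have "\<dots> = 0" using moments[of k] that n by simp
        finally show ?thesis .
      qed
      have "1 / (2 * real N) * (16 * (real q)\<^sup>2 / c) \<le> 1 / (2 * real N) * (16 * (real q)\<^sup>2 / (1 / 2))"
        using c by (intro mult_left_mono divide_left_mono) auto
      then show "1 / (2 * real N) * (16 * (real q)\<^sup>2 / c) \<le> 1 / 2" using small by simp
    qed (use N in auto)
    also have "\<dots> \<le> 8 * (16 * (real q)\<^sup>2 / real N) ^ n"
    proof -
      have "1 / (2 * real N) * (16 * (real q)\<^sup>2 / c) \<le> 1 / (2 * real N) * (16 * (real q)\<^sup>2 / (1 / 2))"
        using c by (intro mult_left_mono divide_left_mono) auto
      then have "1 / (2 * real N) * (16 * (real q)\<^sup>2 / c) \<le> 16 * (real q)\<^sup>2 / real N" by simp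
      then show ?thesis using n c by (simp del: times_divide_eq_left times_divide_eq_right add: power_mono)
    qed
    finally show ?thesis .
  qed
qed

lemma acc_bounds:
  assumes P01: "\<And>amp. (\<Sum>i<d. (amp i)\<^sup>2) = 1 \<Longrightarrow> 0 \<le> P amp \<and> P amp \<le> 1"
    and x: "\<forall>k<N. x k \<in> signed_letters n"
  shows "0 \<le> acc P x" "acc P x \<le> 1"
proof -
  have "0 \<le> P (state x \<tau>) \<and> P (state x \<tau>) \<le> 1" if "\<tau> \<in> {-1, 1}" for \<tau>
    by (rule P01, rule state_facts(1)[OF x that])
  from this[of 1] this[of "-1"] show "0 \<le> acc P x" "acc P x \<le> 1" unfolding acc_def by auto
qed

text \<open>The common part of the power sum is largest when \<open>1 - mass x\<close> is replaced
  by 1. As \<open>1 - \<alpha> < 0\<close>, an upper bound on the power sum is a lower bound on the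
  entropy.\<close>

lemma acc_small:
  assumes P0: "\<And>amp. (\<Sum>i<d. (amp i)\<^sup>2) = 1 \<Longrightarrow> renyi_entropy \<alpha> d (\<lambda>i. (amp i)\<^sup>2) \<ge> h0 \<Longrightarrow> P amp \<le> 1 / 3"
    and x: "\<forall>k<N. x k \<in> signed_letters n"
    and A: "tsum x + (2 * real N) powr \<alpha> * real (d - N) powr (1 - \<alpha>) \<le> A"
    and h0: "h0 = ln ((2 * real N) powr (- \<alpha>) * A) / (1 - \<alpha>)"
  shows "acc P x \<le> 1 / 3"
proof -
  define Z where "Z = (2 * real N) powr (- \<alpha>)"
  have Z: "Z > 0" "Z * (2 * real N) powr \<alpha> = 1" using N by (simp_all add: Z_def flip: powr_add)
  have "P (state x \<tau>) \<le> 1 / 3" if \<tau>: "\<tau> \<in> {-1, 1}" for \<tau>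
  proof (rule P0[OF state_facts(1)[OF x \<tau>]])
    note f = state_facts[OF x \<tau>]
    have "(1 - mass x) powr \<alpha> \<le> 1" using f(3,4) \<alpha> by (intro powr_le1) auto
    then have "(1 - mass x) powr \<alpha> * real (d - N) powr (1 - \<alpha>) \<le> 1 * real (d - N) powr (1 - \<alpha>)"
      by (intro mult_right_mono) auto
    also have "\<dots> = Z * ((2 * real N) powr \<alpha> * real (d - N) powr (1 - \<alpha>))"
      using Z(2) by (simp add: mult.assoc[symmetric])
    finally have "Z * tsum x + (1 - mass x) powr \<alpha> * real (d - N) powr (1 - \<alpha>)
        \<le> Z * (tsum x + (2 * real N) powr \<alpha> * real (d - N) powr (1 - \<alpha>))"
      by (simp add: distrib_left)
    also have "\<dots> \<le> Z * A" using A Z(1) by (intro mult_left_mono) auto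
    finally have "Z * tsum x + (1 - mass x) powr \<alpha> * real (d - N) powr (1 - \<alpha>) \<le> Z * A" .
    moreover have "0 < Z * tsum x + (1 - mass x) powr \<alpha> * real (d - N) powr (1 - \<alpha>)"
      using Z tsum_pos[of x] by (intro add_pos_nonneg) auto
    ultimately have "ln (Z * tsum x + (1 - mass x) powr \<alpha> * real (d - N) powr (1 - \<alpha>)) \<le> ln (Z * A)"
      by (intro ln_mono) auto
    then show "h0 \<le> renyi_entropy \<alpha> d (\<lambda>i. (state x \<tau> i)\<^sup>2)"
      unfolding f(2) h0 Z_def using \<alpha> by (intro divide_right_mono_neg) auto
  qed
  from this[of 1] this[of "-1"] show ?thesis unfolding acc_def by simp
qed

text \<open>Dropping the nonnegative common part bounds the power sum from below, hence the entropy
  from above.\<close>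

lemma acc_large:
  assumes P1: "\<And>amp. (\<Sum>i<d. (amp i)\<^sup>2) = 1 \<Longrightarrow> renyi_entropy \<alpha> d (\<lambda>i. (amp i)\<^sup>2) \<le> h1 \<Longrightarrow> P amp \<ge> 2 / 3"
    and x: "\<forall>k<N. x k \<in> signed_letters n"
    and B: "0 < B" "B \<le> tsum x"
    and h1: "h1 = ln ((2 * real N) powr (- \<alpha>) * B) / (1 - \<alpha>)"
  shows "acc P x \<ge> 2 / 3"
proof -
  define Z where "Z = (2 * real N) powr (- \<alpha>)"
  have Z: "Z > 0" using N by (simp add: Z_def)
  have "P (state x \<tau>) \<ge> 2 / 3" if \<tau>: "\<tau> \<in> {-1, 1}" for \<tau>
  proof (rule P1[OF state_facts(1)[OF x \<tau>]])
    note f = state_facts[OF x \<tau>]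
    have "Z * B \<le> Z * tsum x" using B Z by (intro mult_left_mono) auto
    also have "\<dots> \<le> Z * tsum x + (1 - mass x) powr \<alpha> * real (d - N) powr (1 - \<alpha>)" by simp
    finally have "ln (Z * B) \<le> ln (Z * tsum x + (1 - mass x) powr \<alpha> * real (d - N) powr (1 - \<alpha>))"
      using Z B by (intro ln_mono) auto
    then show "renyi_entropy \<alpha> d (\<lambda>i. (state x \<tau> i)\<^sup>2) \<le> h1"
      unfolding f(2) h1 Z_def using \<alpha> by (intro divide_right_mono_neg) auto
  qed
  from this[of 1] this[of "-1"] show ?thesis unfolding acc_def by simp
qed

text \<open>Markov's inequality bounds the sum of powers from above in the first ensemble; Chebyshev's inequality
  bounds it from below in the second.\<close>

lemma query_lower_bound:
  fixes \<nu>0 \<nu>1 :: "nat \<Rightarrow> real"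
  defines "E0 \<equiv> (\<Sum>j\<le>n. \<nu>0 j * t j powr \<alpha>)" and "E1 \<equiv> (\<Sum>j\<le>n. \<nu>1 j * t j powr \<alpha>)"
  assumes n: "n > 0"
    and \<nu>: "\<And>j. 0 \<le> \<nu>0 j" "\<And>j. 0 \<le> \<nu>1 j" "(\<Sum>j\<le>n. \<nu>0 j) = 1" "(\<Sum>j\<le>n. \<nu>1 j) = 1"
    and moments: "\<And>k. k < n \<Longrightarrow> (\<Sum>j\<le>n. (\<nu>1 j - \<nu>0 j) * t j ^ k) = 0"
    and E0: "0 < E0" and E1: "22 * exp 1 * E0 \<le> E1"
    and junk: "(2 * real N) powr \<alpha> * real (d - N) powr (1 - \<alpha>) \<le> real N * E0"
    and N_large: "40 \<le> real N * E1"
    and \<epsilon>: "2 * \<epsilon> < 1 / (\<alpha> - 1)"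
    and est: "estimates_with d \<epsilon> T (renyi_entropy \<alpha> d)"
    and small: "16 * (real (4 * T + 2))\<^sup>2 / real N \<le> 1 / 2"
  shows "1 / 10 \<le> real N * (8 * (16 * (real (4 * T + 2))\<^sup>2 / real N) ^ n)"
proof -
  have E1_pos: "0 < E1" using E0 E1 by (smt (verit) exp_gt_zero mult_pos_pos)
  define Z where "Z = (2 * real N) powr (- \<alpha>)"
  have Z: "Z > 0" using N by (simp add: Z_def)
  \<comment> \<open>The Markov threshold is ten times the mean \<open>N * E0\<close>; the eleventh
    unit covers the common elements. With \<open>B\<close> half the mean \<open>N * E1\<close>, the
    factor \<open>22 * exp 1\<close> between \<open>E0\<close> and \<open>E1\<close> makes
    \<open>B\<close> at least \<open>exp 1 * A\<close>.\<close>
  define A where "A = 11 * (real N * E0)"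
  define B where "B = real N * E1 / 2"
  have AB: "A > 0" "B > 0" using N E0 E1_pos by (auto simp: A_def B_def)
  define h0 where "h0 = ln (Z * A) / (1 - \<alpha>)"
  define h1 where "h1 = ln (Z * B) / (1 - \<alpha>)"
  have gap: "2 * \<epsilon> < h0 - h1"
  proof -
    have "exp 1 * A \<le> B"
      using mult_left_mono[OF E1, of "real N"] by (simp add: A_def B_def mult_ac)
    then have "exp 1 * (Z * A) \<le> Z * B" using Z mult_left_mono[of "exp 1 * A" B Z] by (simp add: mult_ac)
    then have "ln (exp 1 * (Z * A)) \<le> ln (Z * B)" using Z AB by (intro ln_mono) auto
    then have "1 + ln (Z * A) \<le> ln (Z * B)" using Z AB by (simp add: ln_mult)
    then have "1 / (\<alpha> - 1) \<le> (ln (Z * B) - ln (Z * A)) / (\<alpha> - 1)"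
      using \<alpha> by (intro divide_right_mono) auto
    also have "\<dots> = h0 - h1"
      using minus_divide_divide[of "ln (Z * B) - ln (Z * A)" "\<alpha> - 1"]
      by (simp add: h0_def h1_def diff_divide_distrib)
    finally show ?thesis using \<epsilon> by linarith
  qed
  interpret w0: weights "signed_letters n" "signed_weight \<nu>0" by (rule weights_signed[OF \<nu>(1,3)])
  interpret w1: weights "signed_letters n" "signed_weight \<nu>1" by (rule weights_signed[OF \<nu>(2,4)])
  show ?thesis
  proof (rule threshold_test[OF est gap], goal_cases)
    case (1 P)
    note P01 = 1(1) and P0 = 1(2) and P1 = 1(3) and Ppoly = 1(4)
    have "average (signed_letters n) (signed_weight \<nu>0) N (acc P)
        \<le> average (signed_letters n) (signed_weight \<nu>0) N (\<lambda>x. 1 / 3 + 1 / (10 * (real N * E0)) * tsum x)"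
    proof (rule w0.average_mono)
      fix x assume "\<And>k. k < N \<Longrightarrow> x k \<in> signed_letters n"
      then have x: "\<forall>k<N. x k \<in> signed_letters n" by blast
      show "acc P x \<le> 1 / 3 + 1 / (10 * (real N * E0)) * tsum x"
      proof (cases "tsum x \<le> 10 * (real N * E0)")
        case True
        have "acc P x \<le> 1 / 3"
          by (rule acc_small[OF P0 x, where A = A]) (use True junk h0_def Z_def A_def in auto)
        moreover have "0 \<le> 1 / (10 * (real N * E0)) * tsum x"
          using N E0 tsum_pos[of x] by (intro mult_nonneg_nonneg) auto
        ultimately show ?thesis by linarith
      next
        case False
        then have "1 \<le> 1 / (10 * (real N * E0)) * tsum x" using N E0 by (simp add: field_simps)
        moreover have "acc P x \<le> 1" by (rule acc_bounds(2)[where P = P, OF P01 x])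
        ultimately show ?thesis by linarith
      qed
    qed
    also have "\<dots> = 1 / 3 + 1 / 10"
    proof -
      have "average (signed_letters n) (signed_weight \<nu>0) N tsum = real N * E0"
        unfolding tsum_def w0.average_sum[of N "\<lambda>p. t (fst p) powr \<alpha>"] sum_signed_letters by (simp add: E0_def)
      then show ?thesis
        unfolding w0.average_add w0.average_const w0.average_cmult using N E0 by simp
    qed
    finally have low: "average (signed_letters n) (signed_weight \<nu>0) N (acc P) \<le> 1 / 3 + 1 / 10" .
    define h where "h = (\<lambda>p :: nat \<times> real. t (fst p) powr \<alpha> - E1)"
    define V where "V = (\<Sum>p\<in>signed_letters n. signed_weight \<nu>1 p * (h p)\<^sup>2)"
    have mean: "(\<Sum>p\<in>signed_letters n. signed_weight \<nu>1 p * h p) = 0"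
    proof -
      have "(\<Sum>p\<in>signed_letters n. signed_weight \<nu>1 p * h p) = (\<Sum>j\<le>n. \<nu>1 j * t j powr \<alpha> - E1 * \<nu>1 j)"
        unfolding sum_signed_letters by (intro sum.cong refl) (simp add: h_def field_simps)
      also have "\<dots> = E1 - E1 * (\<Sum>j\<le>n. \<nu>1 j)"
        by (simp add: sum_subtractf E1_def sum_distrib_left)
      finally show ?thesis by (simp add: \<nu>(4))
    qed
    \<comment> \<open>Since \<open>t j powr \<alpha> \<le> 1\<close>, its second moment is at most
      its mean.\<close>
    have V: "V \<le> E1"
    proof -
      have "V = (\<Sum>j\<le>n. \<nu>1 j * (t j powr \<alpha> - E1)\<^sup>2)"
        unfolding V_def sum_signed_letters by (simp add: h_def)
      also have "\<dots> = (\<Sum>j\<le>n. \<nu>1 j * (t j powr \<alpha>)\<^sup>2 - 2 * E1 * (\<nu>1 j * t j powr \<alpha>) + \<nu>1 j * E1\<^sup>2)"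
        by (intro sum.cong refl) (simp add: power2_eq_square algebra_simps)
      also have "\<dots> = (\<Sum>j\<le>n. \<nu>1 j * (t j powr \<alpha>)\<^sup>2) - 2 * E1 * E1 + E1\<^sup>2"
        using \<nu>(4) by (simp add: sum.distrib sum_subtractf E1_def flip: sum_distrib_left sum_distrib_right)
      also have "\<dots> \<le> (\<Sum>j\<le>n. \<nu>1 j * (t j powr \<alpha>)\<^sup>2)" by (simp add: power2_eq_square)
      also have "\<dots> \<le> E1"
        unfolding E1_def
      proof (intro sum_mono mult_left_mono \<nu>)
        fix j assume "j \<in> {..n}"
        then have "t j powr \<alpha> \<le> 1" using t_le[of j] t_pos[of j] \<alpha> by (intro powr_le1) auto
        then show "(t j powr \<alpha>)\<^sup>2 \<le> t j powr \<alpha>"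
          using mult_left_mono[of "t j powr \<alpha>" 1 "t j powr \<alpha>"] by (simp add: power2_eq_square)
      qed
      finally show ?thesis .
    qed
    \<comment> \<open>Chosen so that a deviation of half the mean makes
      \<open>2 / 3 - \<kappa> * (\<Sum>i<N. h (x i))\<^sup>2\<close> nonpositive. This gives
      Chebyshev's inequality as a pointwise bound on \<open>acc P\<close>.\<close>
    define \<kappa> where "\<kappa> = 8 / 3 / (real N * E1)\<^sup>2"
    have "2 / 3 - 1 / 15 \<le> 2 / 3 - \<kappa> * (real N * V)"
    proof -
      have "\<kappa> * (real N * V) \<le> \<kappa> * (real N * E1)"
        using V by (intro mult_left_mono) (auto simp: \<kappa>_def)
      also have "\<dots> = 8 / 3 / (real N * E1)" using N E1_pos by (simp add: \<kappa>_def power2_eq_square)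
      also have "\<dots> \<le> 8 / 3 / 40" using N_large by (intro divide_left_mono) auto
      finally show ?thesis by simp
    qed
    also have "\<dots> = average (signed_letters n) (signed_weight \<nu>1) N (\<lambda>x. 2 / 3 - \<kappa> * (\<Sum>i<N. h (x i))\<^sup>2)"
      unfolding w1.average_diff w1.average_const w1.average_cmult w1.average_sum_square[OF mean] V_def ..
    also have "\<dots> \<le> average (signed_letters n) (signed_weight \<nu>1) N (acc P)"
    proof (rule w1.average_mono)
      fix x assume "\<And>k. k < N \<Longrightarrow> x k \<in> signed_letters n"
      then have x: "\<forall>k<N. x k \<in> signed_letters n" by blast
      have hs: "(\<Sum>i<N. h (x i)) = tsum x - real N * E1"
        by (simp add: h_def tsum_def sum_subtractf)
      show "2 / 3 - \<kappa> * (\<Sum>i<N. h (x i))\<^sup>2 \<le> acc P x"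
      proof (cases "B \<le> tsum x")
        case True
        have "acc P x \<ge> 2 / 3"
          by (rule acc_large[OF P1 x AB(2) True]) (use h1_def Z_def in auto)
        moreover have "0 \<le> \<kappa> * (\<Sum>i<N. h (x i))\<^sup>2" by (simp add: \<kappa>_def)
        ultimately show ?thesis by linarith
      next
        case False
        then have "real N * E1 / 2 \<le> \<bar>\<Sum>i<N. h (x i)\<bar>" unfolding hs B_def by linarith
        then have "(real N * E1 / 2)\<^sup>2 \<le> (\<Sum>i<N. h (x i))\<^sup>2"
          using N E1_pos by (metis abs_ge_zero power2_abs power_mono less_imp_le half_gt_zero mult_pos_pos of_nat_0_less_iff)
        then have "\<kappa> * (real N * E1 / 2)\<^sup>2 \<le> \<kappa> * (\<Sum>i<N. h (x i))\<^sup>2"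
          by (intro mult_left_mono) (simp_all add: \<kappa>_def)
        moreover have "\<kappa> * (real N * E1 / 2)\<^sup>2 = 2 / 3" using N E1_pos by (simp add: \<kappa>_def power_divide)
        moreover have "0 \<le> acc P x" by (rule acc_bounds(1)[where P = P, OF P01 x])
        ultimately show ?thesis by linarith
      qed
    qed
    finally have high: "2 / 3 - 1 / 15 \<le> average (signed_letters n) (signed_weight \<nu>1) N (acc P)" .
    have "\<bar>average (signed_letters n) (signed_weight \<nu>1) N (acc P) - average (signed_letters n) (signed_weight \<nu>0) N (acc P)\<bar>
        \<le> real N * (8 * (16 * (real (4 * T + 2))\<^sup>2 / real N) ^ n)"
    proof (rule average_hybrid[OF w0.weights_axioms w1.weights_axioms])
      fix i and x :: "nat \<Rightarrow> nat \<times> real"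
      assume i: "i < N" and "\<And>k. k < N \<Longrightarrow> k \<noteq> i \<Longrightarrow> x k \<in> signed_letters n"
      then have x: "\<forall>k<N. k \<noteq> i \<longrightarrow> x k \<in> signed_letters n" by blast
      show "\<bar>\<Sum>p\<in>signed_letters n. (signed_weight \<nu>1 p - signed_weight \<nu>0 p) * acc P (x(i := p))\<bar>
          \<le> 8 * (16 * (real (4 * T + 2))\<^sup>2 / real N) ^ n"
        by (rule hybrid_step[OF P01 Ppoly _ n small \<nu> moments i x]) auto
    qed
    \<comment> \<open>The averages differ by at least \<open>1/3 - 1/15 - 1/10 = 1/6\<close>, more
      than the required \<open>1/10\<close>.\<close>
    with low high show ?thesis by linarith
  qed
qed

end

section \<open>Choice of parameters and combination of the two bounds\<close>

lemma diagonal_choice: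
  fixes P :: "real \<Rightarrow> nat \<Rightarrow> bool"
  assumes "\<And>k :: nat. k \<ge> k0 \<Longrightarrow> \<exists>D. \<forall>d\<ge>D. P (1 / real (Suc k)) d"
  obtains g :: "nat \<Rightarrow> real" and D where "g \<longlonglongrightarrow> 0" "\<And>d. d \<ge> D \<Longrightarrow> P (g d) d"
proof -
  obtain D where D: "\<And>k d. k \<ge> k0 \<Longrightarrow> d \<ge> D k \<Longrightarrow> P (1 / real (Suc k)) d"
    using assms by metis
  \<comment> \<open>For each \<open>d\<close> the largest admissible \<open>k\<close> is used; the
    cap \<open>k \<le> d\<close> keeps the set finite. Every fixed \<open>m \<ge> k0\<close> is
    eventually admissible, so the choice tends to infinity.\<close>
  define A where "A = (\<lambda>d. {k. k0 \<le> k \<and> k \<le> d \<and> D k \<le> d})"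
  define K where "K = (\<lambda>d. Max (A d))"
  have fin: "finite (A d)" for d
    by (rule finite_subset[of _ "{..d}"]) (auto simp: A_def)
  have K: "m \<le> K d" "K d \<in> A d" if "k0 \<le> m" "m \<le> d" "D m \<le> d" for m d
  proof -
    have "m \<in> A d" using that by (simp add: A_def)
    then show "m \<le> K d" "K d \<in> A d" unfolding K_def using fin by (auto intro: Max_in)
  qed
  have "(\<lambda>d. 1 / real (Suc (K d))) \<longlonglongrightarrow> 0"
  proof (rule LIMSEQ_I)
    fix r :: real assume "r > 0"
    then obtain m0 where m0: "1 / real (Suc m0) < r" using nat_approx_posE by metis
    define m where "m = max m0 k0"
    have "norm (1 / real (Suc (K d)) - 0) < r" if "d \<ge> max m (D m)" for d
    proof -
      have "m0 \<le> K d" using K(1)[of m d] that by (simp add: m_def)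
      then have "1 / real (Suc (K d)) \<le> 1 / real (Suc m0)" by (intro divide_left_mono) auto
      then show ?thesis using m0 by simp
    qed
    then show "\<exists>no. \<forall>d\<ge>no. norm (1 / real (Suc (K d)) - 0) < r" by blast
  qed
  moreover have "P (1 / real (Suc (K d))) d" if "d \<ge> max k0 (D k0)" for d
    using K(2)[of k0 d] that by (intro D) (auto simp: A_def)
  ultimately show ?thesis by (rule that)
qed

text \<open>Matching \<open>n\<close> moments gives exponent \<open>1/2 - 1/(2*n)\<close>. The
  weaker exponent stated here absorbs all constants depending on \<open>n\<close> and
  \<open>\<alpha>\<close>, at the price of large \<open>d\<close>.\<close>

lemma dimension_lower_bound:
  fixes \<alpha> :: real and n :: nat
  assumes \<alpha>: "\<alpha> > 1" "\<alpha> \<notin> \<int>" and n: "\<alpha> \<le> real n"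
  shows "\<exists>D. \<forall>d\<ge>D. \<forall>\<epsilon> T. 2 * \<epsilon> < 1 / (\<alpha> - 1) \<and> estimates_with d \<epsilon> T (renyi_entropy \<alpha> d) \<longrightarrow>
     real d powr (1/2 - 1 / real n) \<le> real T"
proof -
  have n2: "n \<ge> 2" using n \<alpha> by linarith
  have a0: "0 < \<alpha>" and e0: "0 < 22 * exp (1 :: real)" using \<alpha> by auto
  obtain t \<nu>0 \<nu>1 :: "nat \<Rightarrow> real" where
    t: "\<And>j. 0 < t j" "\<And>j. j \<le> n \<Longrightarrow> t j \<le> 1" and
    \<nu>: "\<And>j. 0 \<le> \<nu>0 j" "\<And>j. 0 \<le> \<nu>1 j" "(\<Sum>j\<le>n. \<nu>0 j) = 1" "(\<Sum>j\<le>n. \<nu>1 j) = 1" and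
    moments: "\<And>k. k < n \<Longrightarrow> (\<Sum>j\<le>n. (\<nu>1 j - \<nu>0 j) * t j ^ k) = 0" and
    E0: "0 < (\<Sum>j\<le>n. \<nu>0 j * t j powr \<alpha>)" and
    E1: "22 * exp 1 * (\<Sum>j\<le>n. \<nu>0 j * t j powr \<alpha>) \<le> (\<Sum>j\<le>n. \<nu>1 j * t j powr \<alpha>)"
    by (rule moment_matching[OF a0 \<alpha>(2) n e0]; rule that; assumption)
  define E0' where "E0' = (\<Sum>j\<le>n. \<nu>0 j * t j powr \<alpha>)"
  define E1' where "E1' = (\<Sum>j\<le>n. \<nu>1 j * t j powr \<alpha>)"
  have E0p: "E0' > 0" using E0 by (simp add: E0'_def)
  have "0 < 22 * exp 1 * E0'" using E0p by simp
  then have E1p: "E1' > 0" using E1 by (simp add: E0'_def E1'_def)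
  have "(\<lambda>k. real k powr (1 - \<alpha>)) \<longlonglongrightarrow> 0"
    using \<alpha> by (intro tendsto_neg_powr filterlim_real_sequentially) simp
  then have "eventually (\<lambda>k. real k powr (1 - \<alpha>) < E0' / 2 powr \<alpha>) sequentially"
    using E0p by (intro order_tendstoD) auto
  then have "eventually (\<lambda>k. real k powr (1 - \<alpha>) < E0' / 2 powr \<alpha> \<and> k \<ge> 1) sequentially"
    using eventually_ge_at_top[of 1] by (rule eventually_conj)
  \<comment> \<open>With at least \<open>K * N\<close> common elements, their part of the power sum,
    rescaled by \<open>(2 * N) powr \<alpha>\<close>, is at most
    \<open>2 powr \<alpha> * K powr (1 - \<alpha>) * N\<close>; this \<open>K\<close> keeps it below
    \<open>N * E0'\<close>.\<close>
  then obtain K :: nat where K: "real K powr (1 - \<alpha>) < E0' / 2 powr \<alpha>" "K \<ge> 1"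
    unfolding eventually_sequentially by blast
  \<comment> \<open>\<open>N\<close> will be \<open>d div (K + 1)\<close>; the factor 2 absorbs the
    rounding, so that \<open>d / C \<le> N\<close>.\<close>
  define C where "C = 2 * real (K + 1)"
  define a where "a = 1/2 - 1 / (2 * real n)"
  define b where "b = 1/2 - 1 / real n"
  have C: "C > 0" by (simp add: C_def)
  have ab: "b < a" "0 < a" using n2 by (auto simp: a_def b_def field_simps)
  have "eventually (\<lambda>d :: nat. real d powr b \<le> ((real d / C) powr a / 36 - 2) / 4) sequentially"
    using ab C by real_asymp
  moreover have "eventually (\<lambda>d :: nat. real d \<ge> C * (40 / E1' + 1)) sequentially"
    by real_asymp
  ultimately have "eventually (\<lambda>d :: nat. real d powr b \<le> ((real d / C) powr a / 36 - 2) / 4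
      \<and> real d \<ge> C * (40 / E1' + 1)) sequentially"
    by (rule eventually_conj)
  then obtain D where D: "\<And>d. d \<ge> D \<Longrightarrow> real d powr b \<le> ((real d / C) powr a / 36 - 2) / 4"
      "\<And>d. d \<ge> D \<Longrightarrow> real d \<ge> C * (40 / E1' + 1)"
    unfolding eventually_sequentially by blast
  have "real d powr b \<le> real T" if d: "d \<ge> D" and \<epsilon>: "2 * \<epsilon> < 1 / (\<alpha> - 1)"
    and est: "estimates_with d \<epsilon> T (renyi_entropy \<alpha> d)" for d \<epsilon> T
  proof -
    define N where "N = d div (K + 1)"
    define q where "q = real (4 * T + 2)"
    have dC: "1 + 40 / E1' \<le> real d / C" using D(2)[OF d] C by (simp add: field_simps)
    have E1q: "40 / E1' > 0" using E1p by simp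
    have NC: "real d / C \<le> real N"
    proof -
      have "2 * (x / (2 * y)) = x / y" for x y :: real by simp
      then have "2 * (real d / C) = real d / real (K + 1)" unfolding C_def .
      also have "\<dots> < real N + 1"
      proof -
        have "d < (N + 1) * (K + 1)" unfolding N_def by (metis add.commute dividend_less_times_div mult.commute mult_Suc plus_1_eq_Suc zero_less_Suc)
        then have "real d < real ((N + 1) * (K + 1))" by (rule of_nat_less_iff[THEN iffD2])
        then show ?thesis by (subst pos_divide_less_eq) (simp_all add: algebra_simps)
      qed
      finally show ?thesis using dC E1q by linarith
    qed
    have N1: "1 < real N" using NC dC E1q by linarith
    have NK: "N * (K + 1) \<le> d" unfolding N_def by (rule div_times_less_eq_dividend)
    then have dN: "K * N \<le> d - N" by (simp add: algebra_simps)
    have Nd: "N < d"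
    proof -
      have "0 < K * N" using K N1 by simp
      then show ?thesis using dN by linarith
    qed
    interpret hard_family \<alpha> t n N d
      by standard (use \<alpha> t N1 Nd in auto)
    have junk: "(2 * real N) powr \<alpha> * real (d - N) powr (1 - \<alpha>) \<le> real N * E0'"
    proof -
      have "real (K * N) \<le> real (d - N)" using dN by (rule of_nat_mono)
      then have "real (d - N) powr (1 - \<alpha>) \<le> real (K * N) powr (1 - \<alpha>)"
        using \<alpha> K N1 by (intro powr_mono2') auto
      then have "(2 * real N) powr \<alpha> * real (d - N) powr (1 - \<alpha>) \<le> (2 * real N) powr \<alpha> * real (K * N) powr (1 - \<alpha>)"
        by (intro mult_left_mono) auto
      also have "\<dots> = (2 powr \<alpha> * real K powr (1 - \<alpha>)) * (real N powr \<alpha> * real N powr (1 - \<alpha>))"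
        by (simp add: powr_mult)
      also have "real N powr \<alpha> * real N powr (1 - \<alpha>) = real N"
        using N1 by (simp flip: powr_add)
      also have "2 powr \<alpha> * real K powr (1 - \<alpha>) * real N \<le> E0' * real N"
        using K(1) N1 by (intro mult_right_mono) (auto simp: field_simps)
      finally show ?thesis by (simp add: mult.commute)
    qed
    have NE: "40 \<le> real N * E1'"
    proof -
      have "40 / E1' \<le> real N" using NC dC by linarith
      then show ?thesis using E1p by (simp add: field_simps)
    qed
    define r where "r = 16 * q\<^sup>2 / real N"
    have r0: "r \<ge> 0" by (simp add: r_def)
    \<comment> \<open>If \<open>r \<le> 1 / 2\<close>, this is the \<open>n\<close>-th root of the
      bound from \<open>query_lower_bound\<close>; otherwise \<open>r\<close> already exceeds the
      left-hand side.\<close>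
    have "real N powr (- 1 / real n) / 80 \<le> r"
    proof (cases "r \<le> 1 / 2")
      case True
      have "1 / 10 \<le> real N * (8 * r ^ n)"
        using query_lower_bound[OF _ \<nu> moments E0 E1 _ _ \<epsilon> est] n2 junk NE True
        by (simp add: r_def q_def E0'_def E1'_def)
      then have "1 / (80 * real N) \<le> r ^ n" using N1 by (simp add: field_simps)
      then have "(1 / (80 * real N)) powr (1 / real n) \<le> (r ^ n) powr (1 / real n)"
        using N1 by (intro powr_mono2) auto
      also have "(r ^ n) powr (1 / real n) = r"
        using r0 n2 by (simp add: powr_powr flip: powr_realpow')
      finally have "(1 / 80) powr (1 / real n) * real N powr (- 1 / real n) \<le> r"
        using N1 by (simp add: powr_divide powr_mult powr_minus_divide)
      moreover have "1 / 80 \<le> (1 / 80) powr (1 / real n)"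
        using powr_mono'[of "1 / real n" 1 "1/80"] n2 by simp
      then have "1 / 80 * real N powr (- 1 / real n) \<le> (1 / 80) powr (1 / real n) * real N powr (- 1 / real n)"
        by (intro mult_right_mono) auto
      ultimately show ?thesis by simp
    next
      case False
      have "real N powr (- 1 / real n) \<le> real N powr 0" using N1 by (intro powr_mono) auto
      then show ?thesis using False N1 by simp
    qed
    then have "real N powr (- 1 / real n) / 80 * real N \<le> 16 * q\<^sup>2"
      using N1 by (simp add: r_def field_simps)
    moreover have "real N powr (- 1 / real n) * real N = real N powr (2 * a)"
    proof -
      have "real N powr (- 1 / real n) * real N = real N powr (- 1 / real n + 1)"
        unfolding powr_add using N1 by simp
      also have "- 1 / real n + 1 = 2 * a" using n2 by (simp add: a_def field_simps)
      finally show ?thesis .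
    qed
    ultimately have "real N powr (2 * a) \<le> 1280 * q\<^sup>2" by simp
    also have "\<dots> \<le> (36 * q)\<^sup>2" by (simp add: power_mult_distrib)
    also have "real N powr (2 * a) = (real N powr a)\<^sup>2"
      using N1 by (simp add: power2_eq_square flip: powr_add)
    finally have "real N powr a \<le> 36 * q"
      by (rule power2_le_imp_le) (simp add: q_def)
    moreover have "(real d / C) powr a \<le> real N powr a"
      using NC C ab by (intro powr_mono2) auto
    ultimately have "(real d / C) powr a / 36 \<le> q" by simp
    then show ?thesis using D(1)[OF d] by (simp add: q_def)
  qed
  then show ?thesis unfolding b_def by blast
qed

theorem theorem2p12:
  fixes \<alpha> :: real
  assumes "\<alpha> > 1" and "\<alpha> \<notin> \<int>"
  shows "\<exists>c > 0. \<exists>\<epsilon>0 > 0. \<exists>g :: nat \<Rightarrow> real. g \<longlonglongrightarrow> 0 \<and>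
           (\<exists>D. \<forall>d \<ge> D. \<forall>\<epsilon>. 0 < \<epsilon> \<and> \<epsilon> < \<epsilon>0 \<longrightarrow>
              (\<forall>T. estimates_with d \<epsilon> T (renyi_entropy \<alpha> d) \<longrightarrow>
                 real T \<ge> c * (real d powr (1/2 - 1/(2*\<alpha>)) / \<epsilon> + real d powr (1/2 - g d))))"
proof -
  obtain c \<epsilon>1 D1 where c: "c > 0" and \<epsilon>1: "\<epsilon>1 > 0" and
    acc: "\<And>d \<epsilon> T. d \<ge> D1 \<Longrightarrow> 0 < \<epsilon> \<Longrightarrow> \<epsilon> < \<epsilon>1 \<Longrightarrow> estimates_with d \<epsilon> T (renyi_entropy \<alpha> d) \<Longrightarrow>
      c * (real d powr (1/2 - 1/(2*\<alpha>)) / \<epsilon>) \<le> real T"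
    using accuracy_lower_bound[OF assms(1)] by blast
  let ?P = "\<lambda>e d. \<forall>\<epsilon> T. 2 * \<epsilon> < 1 / (\<alpha> - 1) \<and> estimates_with d \<epsilon> T (renyi_entropy \<alpha> d) \<longrightarrow>
     real d powr (1/2 - e) \<le> real T"
  \<comment> \<open>\<open>Suc k\<close> moments are matched, and \<open>k\<close> starts where
    \<open>Suc k\<close> reaches \<open>\<alpha>\<close>.\<close>
  have ex: "\<exists>D. \<forall>d\<ge>D. ?P (1 / real (Suc k)) d" if "k \<ge> nat \<lceil>\<alpha>\<rceil>" for k
  proof (rule dimension_lower_bound[OF assms])
    show "\<alpha> \<le> real (Suc k)" using that by linarith
  qed
  obtain g :: "nat \<Rightarrow> real" and D2 where g: "g \<longlonglongrightarrow> 0" and dim: "\<And>d. d \<ge> D2 \<Longrightarrow> ?P (g d) d"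
    by (rule diagonal_choice[where P = ?P, OF ex]; (assumption | (rule that; assumption)))
  \<comment> \<open>Each of the two bounds contributes half of \<open>T\<close>. The second entry of
    \<open>\<epsilon>0\<close> below ensures
    \<open>2 * \<epsilon> < 1 / (\<alpha> - 1)\<close>.\<close>
  define c' where "c' = min (c / 2) (1 / 2)"
  define \<epsilon>0 where "\<epsilon>0 = min \<epsilon>1 (1 / (2 * (\<alpha> - 1)))"
  show ?thesis
  proof (intro exI conjI allI impI)
    show "c' > 0" "\<epsilon>0 > 0" using c \<epsilon>1 assms(1) by (auto simp: c'_def \<epsilon>0_def)
    show "g \<longlonglongrightarrow> 0" by (rule g)
    fix d \<epsilon> T assume d: "max D1 D2 \<le> d" and \<epsilon>: "0 < \<epsilon> \<and> \<epsilon> < \<epsilon>0"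
      and est: "estimates_with d \<epsilon> T (renyi_entropy \<alpha> d)"
    define X where "X = real d powr (1/2 - 1/(2*\<alpha>)) / \<epsilon>"
    define Y where "Y = real d powr (1/2 - g d)"
    have "2 * (1 / (2 * x)) = 1 / x" for x :: real by simp
    moreover have "2 * \<epsilon> < 2 * (1 / (2 * (\<alpha> - 1)))" using \<epsilon> by (simp add: \<epsilon>0_def)
    ultimately have "2 * \<epsilon> < 1 / (\<alpha> - 1)" by metis
    then have Y: "Y \<le> real T" "0 \<le> Y" using dim[of d] d est by (auto simp: Y_def)
    have X: "c * X \<le> real T" "0 \<le> X" using acc[of d \<epsilon> T] d \<epsilon> est by (auto simp: X_def \<epsilon>0_def)
    have "c' * (X + Y) \<le> c / 2 * X + 1 / 2 * Y"
      unfolding distrib_left using X Y by (intro add_mono mult_right_mono) (auto simp: c'_def)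
    also have "\<dots> \<le> real T" using X Y by simp
    finally show "real T \<ge> c' * (real d powr (1/2 - 1/(2*\<alpha>)) / \<epsilon> + real d powr (1/2 - g d))"
      by (simp add: X_def Y_def)
  qed
qed

end
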